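(* Let $K\subset\mathbb{R}^n$ be compact, $m\ge1$, $p>n$, and $F\in W^{m,p}(\mathbb{R}^n)$. Define the jet $\vec f=\{f^{(j)}\}_{|j|\le m-1}$ on $K$ by $f^{(j)}=D^jF|_K$ (continuous representatives). Then $\|M^{(m)}\vec f\|_{L^p(\mathbb{R}^n)}\lesssim\|\nabla^mF\|_{L^p(\mathbb{R}^n)}$, with a constant depending only on $n,m,p$.
   Context: $P^{(m-1)}_y\vec f(x)=\sum_{|j|\le m-1}\frac1{j!}f^{(j)}(y)(x-y)^j$ and $M^{(m)}\vec f(x)=\sup_{y,z\in K,\,y\ne z}\frac{|P^{(m-1)}_y\vec f(x)-P^{(m-1)}_z\vec f(x)|}{|x-y|^m+|x-z|^m}$. *)

theory Defs
  imports "HOL-Analysis.Analysis"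
begin

definition mi_abs :: "('n::finite \<Rightarrow> nat) \<Rightarrow> nat" where
  "mi_abs \<alpha> = (\<Sum>i\<in>UNIV. \<alpha> i)"

definition mi_fact :: "('n::finite \<Rightarrow> nat) \<Rightarrow> real" where
  "mi_fact \<alpha> = (\<Prod>i\<in>UNIV. fact (\<alpha> i))"

definition mi_pow :: "real^'n::finite \<Rightarrow> ('n \<Rightarrow> nat) \<Rightarrow> real" where
  "mi_pow v \<alpha> = (\<Prod>i\<in>UNIV. (v $ i) ^ (\<alpha> i))"

definition pdiff :: "'n::finite \<Rightarrow> (real^'n \<Rightarrow> real) \<Rightarrow> real^'n \<Rightarrow> real" where
  "pdiff i f x = deriv (\<lambda>t. f (x + t *\<^sub>R axis i 1)) 0"

fun pdiffs :: "'n::finite list \<Rightarrow> (real^'n \<Rightarrow> real) \<Rightarrow> real^'n \<Rightarrow> real" where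
  "pdiffs [] f = f"
| "pdiffs (i # is) f = pdiff i (pdiffs is f)"

text \<open>A fixed enumeration of the coordinates, used to turn a multi-index into a list of
  directions (the order is irrelevant for smooth test functions).\<close>

definition coord_list :: "'n::finite list" where
  "coord_list = (SOME xs. distinct xs \<and> set xs = UNIV)"

definition mi_list :: "('n::finite \<Rightarrow> nat) \<Rightarrow> 'n list" where
  "mi_list \<alpha> = concat (map (\<lambda>i. replicate (\<alpha> i) i) coord_list)"

definition Dcl :: "('n::finite \<Rightarrow> nat) \<Rightarrow> (real^'n \<Rightarrow> real) \<Rightarrow> real^'n \<Rightarrow> real" where
  "Dcl \<alpha> f = pdiffs (mi_list \<alpha>) f"

definition test_fun :: "(real^'n::finite \<Rightarrow> real) \<Rightarrow> bool" where
  "test_fun \<phi> \<longleftrightarrow>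
     (\<forall>is. continuous_on UNIV (pdiffs is \<phi>) \<and>
           (\<forall>i x. (\<lambda>t. pdiffs is \<phi> (x + t *\<^sub>R axis i 1)) differentiable (at 0))) \<and>
     compact (closure {x. \<phi> x \<noteq> 0})"

definition Lp :: "real \<Rightarrow> (real^'n::finite \<Rightarrow> real) \<Rightarrow> bool" where
  "Lp p f \<longleftrightarrow> f \<in> borel_measurable lborel \<and> integrable lborel (\<lambda>x. \<bar>f x\<bar> powr p)"

definition Lp_norm :: "real \<Rightarrow> (real^'n::finite \<Rightarrow> real) \<Rightarrow> real" where
  "Lp_norm p f = (\<integral>x. \<bar>f x\<bar> powr p \<partial>lborel) powr (1 / p)"

definition weak_deriv :: "('n::finite \<Rightarrow> nat) \<Rightarrow> (real^'n \<Rightarrow> real) \<Rightarrow> (real^'n \<Rightarrow> real) \<Rightarrow> bool" where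
  "weak_deriv \<alpha> F G \<longleftrightarrow>
     (\<forall>\<phi>. test_fun \<phi> \<longrightarrow>
        integrable lborel (\<lambda>x. F x * Dcl \<alpha> \<phi> x) \<and>
        integrable lborel (\<lambda>x. G x * \<phi> x) \<and>
        (\<integral>x. F x * Dcl \<alpha> \<phi> x \<partial>lborel) = (-1) ^ mi_abs \<alpha> * (\<integral>x. G x * \<phi> x \<partial>lborel))"

definition sobolev :: "nat \<Rightarrow> real \<Rightarrow> (real^'n::finite \<Rightarrow> real) \<Rightarrow> bool" where
  "sobolev m p F \<longleftrightarrow> Lp p F \<and> (\<forall>\<alpha>. mi_abs \<alpha> \<le> m \<longrightarrow> (\<exists>G. Lp p G \<and> weak_deriv \<alpha> F G))"

definition grad_norm :: "nat \<Rightarrow> (('n::finite \<Rightarrow> nat) \<Rightarrow> real^'n \<Rightarrow> real) \<Rightarrow> real^'n \<Rightarrow> real" where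
  "grad_norm m D x = sqrt (\<Sum>\<alpha>\<in>{\<alpha>. mi_abs \<alpha> = m}. (D \<alpha> x)\<^sup>2)"

definition taylor_jet :: "nat \<Rightarrow> (('n::finite \<Rightarrow> nat) \<Rightarrow> real^'n \<Rightarrow> real) \<Rightarrow> real^'n \<Rightarrow> real^'n \<Rightarrow> real" where
  "taylor_jet m f y x = (\<Sum>j\<in>{j. mi_abs j \<le> m - 1}. f j y / mi_fact j * mi_pow (x - y) j)"

definition Mjet :: "nat \<Rightarrow> (real^'n::finite) set \<Rightarrow> (('n \<Rightarrow> nat) \<Rightarrow> real^'n \<Rightarrow> real) \<Rightarrow> real^'n \<Rightarrow> ennreal" where
  "Mjet m K f x = (SUP yz\<in>{(y, z). y \<in> K \<and> z \<in> K \<and> y \<noteq> z}.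
      ennreal (\<bar>taylor_jet m f (fst yz) x - taylor_jet m f (snd yz) x\<bar> /
               (norm (x - fst yz) ^ m + norm (x - snd yz) ^ m)))"

definition enn_powr :: "ennreal \<Rightarrow> real \<Rightarrow> ennreal" where
  "enn_powr a q = (if a = \<infinity> then \<infinity> else ennreal (enn2real a powr q))"

definition Lp_norm_enn :: "real \<Rightarrow> (real^'n::finite \<Rightarrow> ennreal) \<Rightarrow> ennreal" where
  "Lp_norm_enn p g = enn_powr (\<integral>\<^sup>+ x. enn_powr (g x) p \<partial>lborel) (1 / p)"

end

theory Submission
  imports Defs
begin

text \<open>
  Fix \<open>n < q < p\<close> and let \<open>N(x)\<^sup>q\<close> be the maximal function of \<open>|\<nabla>\<^sup>mF|\<^sup>q\<close> at \<open>x\<close>. Everything rests on the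
  pointwise bound \<open>|P\<^sub>xf(x) - P\<^sub>yf(x)| \<le> C |x - y|\<^sup>m N(x)\<close>: by the triangle inequality it gives
  \<open>M\<^sup>(\<^sup>m\<^sup>)f \<le> C N\<close>, and the Hardy--Littlewood theorem in \<open>L\<^bsup>p/q\<^esup>\<close> bounds \<open>N\<close> in \<open>L\<^sup>p\<close>.

  For a bump \<open>\<psi>\<close> consider \<open>\<Phi>(s) = \<integral> f(y + s z) \<psi>(z) dz\<close>. Weak differentiability alone makes \<open>\<Phi>\<close>
  \<open>m\<close> times differentiable for \<open>s > 0\<close>, and its Taylor polynomial at \<open>s = 0\<close> is
  \<open>\<integral> P\<^sub>yf(y + s z) \<psi>(z) dz\<close>. Since \<open>\<Phi>\<^sup>(\<^sup>m\<^sup>)(s)\<close> is at most \<open>C (\<rho>/s)\<^bsup>n/q\<^esup> N(x)\<close> for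
  \<open>s \<le> \<rho>\<close> and \<open>|x - y| \<le> \<rho>\<close>, the average of \<open>f - P\<^sub>yf\<close> at scale \<open>\<rho>\<close> is at most \<open>C \<rho>\<^sup>m N(x)\<close>. Translating \<open>\<psi>\<close>
  centres these averages at \<open>x\<close>, so the averages of \<open>P\<^sub>xf - P\<^sub>yf\<close> around \<open>x\<close> at the scales
  \<open>k |x - y|\<close>, \<open>1 \<le> k \<le> m\<close>, are under control; a finite difference in \<open>k\<close> recovers the value at \<open>x\<close>.
\<close>

section \<open>The Hardy--Littlewood maximal theorem\<close>

text \<open>The uncentred maximal function is used because its superlevel sets are unions of open balls,
  hence open. Averages are normalised by \<open>\<rho>\<^sup>n\<close> instead of the volume of the ball.\<close>

definition hl_max :: "('a::euclidean_space \<Rightarrow> ennreal) \<Rightarrow> 'a \<Rightarrow> ennreal" where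
  "hl_max u x = (SUP (c, \<rho>)\<in>{(c, \<rho>). x \<in> ball c \<rho>}.
      ennreal (1 / \<rho> ^ DIM('a)) * (\<integral>\<^sup>+ y. u y * indicator (ball c \<rho>) y \<partial>lborel))"

lemma mult_inverse_less_ennreal_iff:
  assumes "t > 0"
  shows "a < ennreal (1 / t) * b \<longleftrightarrow> ennreal t * a < b"
proof -
  have "ennreal t * (ennreal (1 / t) * b) = b"
    using assms by (simp add: mult.assoc[symmetric] ennreal_mult[symmetric])
  then show ?thesis
    using ennreal_mult_strict_left_mono[of a "ennreal (1 / t) * b" "ennreal t"]
      ennreal_mult_le_mult_iff[of "ennreal t" "ennreal (1 / t) * b" a] assms
    by (auto simp: not_less[symmetric])
qed

lemma less_hl_max_iff:
  fixes u :: "'a::euclidean_space \<Rightarrow> ennreal"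
  shows "\<kappa> < hl_max u x \<longleftrightarrow>
    (\<exists>c \<rho>. x \<in> ball c \<rho> \<and> ennreal (\<rho> ^ DIM('a)) * \<kappa> < (\<integral>\<^sup>+ y. u y * indicator (ball c \<rho>) y \<partial>lborel))"
proof -
  have pos: "0 < \<rho> ^ DIM('a)" if "x \<in> ball c \<rho>" for c \<rho>
    using that by (intro zero_less_power) (use zero_le_dist[of c x] in \<open>simp only: mem_ball\<close>)
  show ?thesis
    unfolding hl_max_def less_SUP_iff Bex_def split_paired_Ex mem_Collect_eq prod.case
    by (intro ex_cong1 conj_cong refl mult_inverse_less_ennreal_iff) (rule pos)
qed

lemma nn_integral_ball_le_hl_max:
  fixes u :: "'a::euclidean_space \<Rightarrow> ennreal"
  assumes "hl_max u x \<le> \<kappa>" "\<rho> > 0"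
  shows "(\<integral>\<^sup>+ y. u y * indicator (ball x \<rho>) y \<partial>lborel) \<le> ennreal (\<rho> ^ DIM('a)) * \<kappa>"
proof (rule ccontr)
  assume "\<not> ?thesis"
  moreover have "x \<in> ball x \<rho>" using assms by simp
  ultimately have "\<kappa> < hl_max u x"
    unfolding less_hl_max_iff not_le by blast
  with assms show False by (simp add: not_less[symmetric])
qed

lemma superlevel_hl_max:
  fixes u :: "'a::euclidean_space \<Rightarrow> ennreal"
  shows "{x. \<kappa> < hl_max u x} = (\<Union>i\<in>{i. 0 < snd i \<and> ennreal (snd i ^ DIM('a)) * \<kappa> <
    (\<integral>\<^sup>+ y. u y * indicator (ball (fst i) (snd i)) y \<partial>lborel)}. ball (fst i) (snd i))"
proof -
  have pos: "0 < \<rho>" if "x \<in> ball c \<rho>" for x c :: 'a and \<rho>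
    using that zero_le_dist[of c x] by (simp only: mem_ball)
  show ?thesis
    unfolding less_hl_max_iff set_eq_iff mem_Collect_eq UN_iff Bex_def split_paired_Ex fst_conv snd_conv
    using pos by blast
qed

lemma borel_measurable_hl_max [measurable]: "hl_max u \<in> borel_measurable borel"
proof (rule borel_measurableI_greater)
  fix y
  have "open {x. y < hl_max u x}"
    unfolding superlevel_hl_max by (auto intro!: open_UN)
  then show "{x \<in> space borel. y < hl_max u x} \<in> sets borel"
    by simp
qed

lemma hl_max_weak_type:
  fixes u :: "'a::euclidean_space \<Rightarrow> ennreal"
  assumes [measurable]: "u \<in> borel_measurable borel" and "\<kappa> > 0"
  shows "emeasure lborel {x. ennreal \<kappa> < hl_max u x}
    \<le> ennreal (unit_ball_vol (real DIM('a)) * 5 ^ DIM('a) / \<kappa>) * (\<integral>\<^sup>+ y. u y \<partial>lborel)"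
proof (cases "(\<integral>\<^sup>+ y. u y \<partial>lborel) = \<infinity>")
  case True
  have "unit_ball_vol (real DIM('a)) * 5 ^ DIM('a) / \<kappa> > 0"
    using assms by simp
  then have "ennreal (unit_ball_vol (real DIM('a)) * 5 ^ DIM('a) / \<kappa>) * (\<integral>\<^sup>+ y. u y \<partial>lborel) = top"
    unfolding True infinity_ennreal_def by (simp only: ennreal_mult_top ennreal_eq_0_iff not_le[symmetric] if_False)
  then show ?thesis
    by simp
next
  case False
  define V where "V = unit_ball_vol (real DIM('a))"
  have V: "V > 0" by (simp add: V_def)
  obtain I where I: "(\<integral>\<^sup>+ y. u y \<partial>lborel) = ennreal I" "I \<ge> 0"
    using False by (cases "\<integral>\<^sup>+ y. u y \<partial>lborel") auto
  define S where "S = {i. 0 < snd i \<and> ennreal (snd i ^ DIM('a)) * ennreal \<kappa> <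
    (\<integral>\<^sup>+ y. u y * indicator (ball (fst i) (snd i)) y \<partial>lborel)}"
  have "snd i \<le> root DIM('a) (I / \<kappa>)" if "i \<in> S" for i
  proof -
    have "snd i > 0"
      using that by (simp add: S_def)
    have "ennreal (snd i ^ DIM('a)) * \<kappa> < (\<integral>\<^sup>+ y. u y * indicator (ball (fst i) (snd i)) y \<partial>lborel)"
      using that by (simp add: S_def)
    also have "\<dots> \<le> (\<integral>\<^sup>+ y. u y \<partial>lborel)"
      by (intro nn_integral_mono) (auto split: split_indicator)
    finally have "snd i ^ DIM('a) * \<kappa> < I"
      using I assms \<open>snd i > 0\<close> by (simp add: ennreal_mult[symmetric] ennreal_less_iff)
    then have "snd i ^ DIM('a) \<le> I / \<kappa>"
      using assms by (simp add: field_simps)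
    then have "root DIM('a) (snd i ^ DIM('a)) \<le> root DIM('a) (I / \<kappa>)"
      by simp
    then show ?thesis
      using \<open>snd i > 0\<close> by (simp add: real_root_power_cancel)
  qed
  then have rad: "\<And>i. i \<in> S \<Longrightarrow> 0 < snd i \<and> snd i \<le> root DIM('a) (I / \<kappa>)"
    by (auto simp: S_def)
  obtain C where C: "countable C" "C \<subseteq> S"
     "pairwise (\<lambda>i j. disjnt (cball (fst i) (snd i)) (cball (fst j) (snd j))) C"
     and cover: "\<forall>i\<in>S. \<exists>j\<in>C. cball (fst i) (snd i) \<subseteq> ball (fst j) (5 * snd j)"
    by (rule Vitali_covering_lemma_cballs_balls[where K = S and r = snd and a = fst, OF rad], assumption)
      (rule that, assumption+, meson)
  define J where "J = to_nat_on C ` C"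
  define c where "c = (\<lambda>n. fst (from_nat_into C n))"
  define r where "r = (\<lambda>n. snd (from_nat_into C n))"
  define X where "X = (\<lambda>n. if n \<in> J then ball (c n) (5 * r n) else {})"
  define Y where "Y = (\<lambda>n. if n \<in> J then ball (c n) (r n) else {})"
  have J: "from_nat_into C n \<in> C" "to_nat_on C (from_nat_into C n) = n" if "n \<in> J" for n
    using that C by (auto simp: J_def)
  have sub: "{x. ennreal \<kappa> < hl_max u x} \<subseteq> (\<Union>n. X n)"
  proof
    fix x assume "x \<in> {x. ennreal \<kappa> < hl_max u x}"
    then obtain i where i: "i \<in> S" "x \<in> ball (fst i) (snd i)"
      unfolding superlevel_hl_max S_def[symmetric] by blast
    then obtain j where j: "j \<in> C" "cball (fst i) (snd i) \<subseteq> ball (fst j) (5 * snd j)"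
      using cover by blast
    then have "x \<in> ball (fst j) (5 * snd j)"
      using i ball_subset_cball by blast
    then have "x \<in> X (to_nat_on C j)"
      using j C(1) by (simp add: X_def J_def c_def r_def)
    then show "x \<in> (\<Union>n. X n)" by blast
  qed
  have disj: "disjoint_family Y"
    unfolding disjoint_family_on_def
  proof (intro ballI impI)
    fix k l :: nat assume kl: "k \<noteq> l"
    show "Y k \<inter> Y l = {}"
    proof (cases "k \<in> J \<and> l \<in> J")
      case True
      then have "from_nat_into C k \<noteq> from_nat_into C l"
        using J kl by metis
      then have "disjnt (cball (c k) (r k)) (cball (c l) (r l))"
        using C(3) J True unfolding pairwise_def c_def r_def by blast
      then show ?thesis
        using True ball_subset_cball[of "c k" "r k"] ball_subset_cball[of "c l" "r l"]
        unfolding Y_def disjnt_def if_P by (simp only: if_True conj_absorb) blast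
    qed (auto simp: Y_def)
  qed
  have XY: "emeasure lborel (X n) \<le> ennreal (V * 5 ^ DIM('a) / \<kappa>) * emeasure (density lborel u) (Y n)" for n
  proof (cases "n \<in> J")
    case True
    then have n: "r n > 0" "ennreal (r n ^ DIM('a)) * \<kappa> < (\<integral>\<^sup>+ y. u y * indicator (ball (c n) (r n)) y \<partial>lborel)"
      using J(1)[OF True] C(2) by (auto simp: S_def c_def r_def)
    have "emeasure lborel (X n) = ennreal (V * (5 * r n) ^ DIM('a))"
      using True n by (simp add: X_def emeasure_ball V_def)
    also have "\<dots> = ennreal (V * 5 ^ DIM('a) / \<kappa>) * (ennreal (r n ^ DIM('a)) * \<kappa>)"
      using n V assms by (simp add: ennreal_mult[symmetric] power_mult_distrib)
    also have "\<dots> \<le> ennreal (V * 5 ^ DIM('a) / \<kappa>) * emeasure (density lborel u) (Y n)"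
      using n True by (intro mult_left_mono) (auto simp: emeasure_density Y_def)
    finally show ?thesis .
  qed (simp add: X_def)
  have "emeasure lborel {x. ennreal \<kappa> < hl_max u x} \<le> emeasure lborel (\<Union>n. X n)"
    using sub by (intro emeasure_mono) (auto simp: X_def)
  also have "\<dots> \<le> (\<Sum>n. emeasure lborel (X n))"
    by (rule emeasure_subadditive_countably) (auto simp: X_def)
  also have "\<dots> \<le> (\<Sum>n. ennreal (V * 5 ^ DIM('a) / \<kappa>) * emeasure (density lborel u) (Y n))"
    by (intro suminf_le XY) auto
  also have "\<dots> = ennreal (V * 5 ^ DIM('a) / \<kappa>) * emeasure (density lborel u) (\<Union>n. Y n)"
    using disj by (subst ennreal_suminf_cmult, subst suminf_emeasure) (auto simp: Y_def)
  also have "\<dots> \<le> ennreal (V * 5 ^ DIM('a) / \<kappa>) * emeasure (density lborel u) UNIV"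
    by (intro mult_left_mono emeasure_mono) auto
  finally show ?thesis
    by (simp add: emeasure_density V_def)
qed

lemma nn_integral_powr_from_0:
  assumes "a > -1" "c \<ge> 0"
  shows "(\<integral>\<^sup>+ t. ennreal (t powr a) * indicator {0<..<c} t \<partial>lborel) = ennreal (c powr (a + 1) / (a + 1))"
proof -
  have "(\<integral>\<^sup>+ t. ennreal (t powr a) * indicator {0<..<c} t \<partial>lborel)
      = (\<integral>\<^sup>+ t. ennreal (t powr a) * indicator {0..c} t \<partial>lborel)"
    using AE_lborel_singleton[of 0] AE_lborel_singleton[of c]
    by (intro nn_integral_cong_AE) (auto split: split_indicator)
  also have "\<dots> = ennreal (c powr (a + 1) / (a + 1))"
    using has_integral_powr_from_0[of a c] assms by (intro nn_integral_has_integral_lebesgue') auto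
  finally show ?thesis .
qed

lemma enn_powr_le_layer_cake:
  assumes "r > 0"
  shows "enn_powr a r \<le> ennreal r * (\<integral>\<^sup>+ t. ennreal (t powr (r - 1)) * indicator {t. 0 < t \<and> ennreal t < a} t \<partial>lborel)"
    (is "_ \<le> _ * ?I a")
proof -
  have fin: "ennreal (c powr r) \<le> ennreal r * ?I b" if "c \<ge> 0" "ennreal c \<le> b" for c b
  proof -
    have "ennreal (c powr r) = ennreal r * ennreal (c powr (r - 1 + 1) / (r - 1 + 1))"
      using assms by (simp add: ennreal_mult[symmetric])
    also have "\<dots> = ennreal r * (\<integral>\<^sup>+ t. ennreal (t powr (r - 1)) * indicator {0<..<c} t \<partial>lborel)"
      using assms that by (subst nn_integral_powr_from_0) auto
    also have "\<dots> \<le> ennreal r * ?I b"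
    proof (rule mult_left_mono, rule nn_integral_mono)
      fix t :: real
      have "t < c \<Longrightarrow> 0 < t \<Longrightarrow> ennreal t < b"
        using that ennreal_lessI[of c t] by (auto intro: less_le_trans)
      then show "ennreal (t powr (r - 1)) * indicator {0<..<c} t \<le>
        ennreal (t powr (r - 1)) * indicator {t. 0 < t \<and> ennreal t < b} t"
        by (auto split: split_indicator)
    qed auto
    finally show ?thesis .
  qed
  show ?thesis
  proof (cases a)
    case (real c)
    then show ?thesis
      using fin[of c a] by (simp add: enn_powr_def)
  next
    case top
    have "ennreal x \<le> ennreal r * ?I a" if "x \<ge> 0" for x
      using fin[of "x powr (1 / r)" a] that assms top by (simp add: powr_powr)
    have "\<not> ennreal r * ?I a < \<infinity>"
    proof
      assume "ennreal r * ?I a < \<infinity>"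
      then obtain b where "ennreal r * ?I a = ennreal b" "b \<ge> 0"
        by (cases "ennreal r * ?I a") auto
      with \<open>\<And>x. x \<ge> 0 \<Longrightarrow> ennreal x \<le> ennreal r * ?I a\<close>[of "b + 1"] show False
        by (simp del: ennreal_plus)
    qed
    then have "top \<le> ennreal r * ?I a" by (simp add: not_less)
    then show ?thesis by (rule order_trans[OF top_greatest])
  qed
qed

theorem hl_max_strong_type:
  fixes r :: real
  assumes r: "r > 1"
  shows "\<exists>C>0. \<forall>u::'a::euclidean_space \<Rightarrow> real. u \<in> borel_measurable borel \<longrightarrow> (\<forall>x. u x \<ge> 0) \<longrightarrow>
    (\<integral>\<^sup>+ x. enn_powr (hl_max u x) r \<partial>lborel) \<le> ennreal C * (\<integral>\<^sup>+ x. ennreal (u x powr r) \<partial>lborel)"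
proof -
  define V where "V = unit_ball_vol (real DIM('a))"
  have V: "V > 0" by (simp add: V_def)
  define A where "A = 2 * V * 5 ^ DIM('a)"
  have A: "A > 0" using V by (simp add: A_def)
  define C where "C = r * A * ((2 * V) powr (r - 1) / (r - 1))"
  have "C > 0" using r A V by (simp add: C_def)
  moreover have "(\<integral>\<^sup>+ x. enn_powr (hl_max u x) r \<partial>lborel) \<le> ennreal C * (\<integral>\<^sup>+ x. ennreal (u x powr r) \<partial>lborel)"
    if [measurable]: "u \<in> borel_measurable borel" and u: "\<And>x. u x \<ge> 0" for u :: "'a \<Rightarrow> real"
  proof -
    define v where "v = (\<lambda>t x. if t / (2 * V) < u x then ennreal (u x) else 0)"
    have v [measurable]: "v t \<in> borel_measurable borel" for t
      unfolding v_def by measurable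
    have level: "emeasure lborel {x. ennreal t < hl_max u x} \<le> ennreal (A / t) * (\<integral>\<^sup>+ x. v t x \<partial>lborel)"
      if t: "t > 0" for t
    proof -
      have "ennreal (t / 2) < hl_max (v t) x" if x: "ennreal t < hl_max u x" for x
      proof -
        obtain c \<rho> where c: "x \<in> ball c \<rho>"
          "ennreal (\<rho> ^ DIM('a)) * t < (\<integral>\<^sup>+ y. ennreal (u y) * indicator (ball c \<rho>) y \<partial>lborel)"
          using x unfolding less_hl_max_iff by blast
        then have \<rho>: "\<rho> > 0"
          using zero_le_dist[of c x] by (simp only: mem_ball)
        have [measurable]: "ball c \<rho> \<in> sets borel" by simp
        have "(\<integral>\<^sup>+ y. ennreal (u y) * indicator (ball c \<rho>) y \<partial>lborel)
            \<le> (\<integral>\<^sup>+ y. v t y * indicator (ball c \<rho>) y + ennreal (t / (2 * V)) * indicator (ball c \<rho>) y \<partial>lborel)"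
          by (intro nn_integral_mono) (auto simp: v_def split: split_indicator intro!: ennreal_leI)
        also have "\<dots> = (\<integral>\<^sup>+ y. v t y * indicator (ball c \<rho>) y \<partial>lborel) + ennreal (t / (2 * V)) * emeasure lborel (ball c \<rho>)"
          by (subst nn_integral_add) (measurable, measurable, simp add: nn_integral_cmult_indicator)
        also have "ennreal (t / (2 * V)) * emeasure lborel (ball c \<rho>) = ennreal (\<rho> ^ DIM('a) * (t / 2))"
          using \<rho> t V by (simp add: emeasure_ball V_def[symmetric] ennreal_mult[symmetric])
        finally have "ennreal (\<rho> ^ DIM('a) * t) <
            (\<integral>\<^sup>+ y. v t y * indicator (ball c \<rho>) y \<partial>lborel) + ennreal (\<rho> ^ DIM('a) * (t / 2))"
          using c(2) \<rho> t by (simp add: ennreal_mult[symmetric])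
        then have "ennreal (\<rho> ^ DIM('a) * (t / 2)) < (\<integral>\<^sup>+ y. v t y * indicator (ball c \<rho>) y \<partial>lborel)"
        proof (cases "\<integral>\<^sup>+ y. v t y * indicator (ball c \<rho>) y \<partial>lborel")
          case (real s)
          assume "ennreal (\<rho> ^ DIM('a) * t) <
            (\<integral>\<^sup>+ y. v t y * indicator (ball c \<rho>) y \<partial>lborel) + ennreal (\<rho> ^ DIM('a) * (t / 2))"
          with real \<rho> t have "\<rho> ^ DIM('a) * t < s + \<rho> ^ DIM('a) * (t / 2)"
            by (simp add: ennreal_plus[symmetric] ennreal_less_iff del: ennreal_plus)
          with real \<rho> t show ?thesis
            by (simp add: ennreal_less_iff)
        qed simp
        then show ?thesis
          unfolding less_hl_max_iff using c(1) \<rho> t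
          by (intro exI[of _ c] exI[of _ \<rho>]) (simp add: ennreal_mult[symmetric])
      qed
      then have "emeasure lborel {x. ennreal t < hl_max u x} \<le> emeasure lborel {x. ennreal (t / 2) < hl_max (v t) x}"
        by (intro emeasure_mono) auto
      also have "\<dots> \<le> ennreal (V * 5 ^ DIM('a) / (t / 2)) * (\<integral>\<^sup>+ x. v t x \<partial>lborel)"
        using t unfolding V_def by (intro hl_max_weak_type) auto
      finally show ?thesis by (simp add: A_def mult_ac)
    qed
    have "(\<integral>\<^sup>+ x. enn_powr (hl_max u x) r \<partial>lborel) \<le> (\<integral>\<^sup>+ x. ennreal r * (\<integral>\<^sup>+ t. (if 0 < t \<and> ennreal t < hl_max u x then ennreal (t powr (r - 1)) else 0) \<partial>lborel) \<partial>lborel)"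
    proof (rule nn_integral_mono)
      fix x
      have "(\<integral>\<^sup>+ t. ennreal (t powr (r - 1)) * indicator {t. 0 < t \<and> ennreal t < hl_max u x} t \<partial>lborel) =
        (\<integral>\<^sup>+ t. (if 0 < t \<and> ennreal t < hl_max u x then ennreal (t powr (r - 1)) else 0) \<partial>lborel)"
        by (intro nn_integral_cong) (auto split: split_indicator)
      then show "enn_powr (hl_max u x) r \<le> ennreal r *
          (\<integral>\<^sup>+ t. (if 0 < t \<and> ennreal t < hl_max u x then ennreal (t powr (r - 1)) else 0) \<partial>lborel)"
        using enn_powr_le_layer_cake[of r "hl_max u x"] r by simp
    qed
    also have "\<dots> = ennreal r * (\<integral>\<^sup>+ x. \<integral>\<^sup>+ t. (if 0 < t \<and> ennreal t < hl_max u x then ennreal (t powr (r - 1)) else 0) \<partial>lborel \<partial>lborel)"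
      by (intro nn_integral_cmult) measurable
    also have "\<dots> = ennreal r * (\<integral>\<^sup>+ t. \<integral>\<^sup>+ x. (if 0 < t \<and> ennreal t < hl_max u x then ennreal (t powr (r - 1)) else 0) \<partial>lborel \<partial>lborel)"
      by (intro arg_cong2[where f = "(*)"] refl lborel_pair.Fubini') measurable
    also have "\<dots> \<le> ennreal r * (\<integral>\<^sup>+ t. \<integral>\<^sup>+ x. ennreal (t powr (r - 1)) * indicator {0<..} t * (ennreal (A / t) * v t x) \<partial>lborel \<partial>lborel)"
    proof (rule mult_left_mono, rule nn_integral_mono)
      fix t :: real
      have "(\<integral>\<^sup>+ x. (if 0 < t \<and> ennreal t < hl_max u x then ennreal (t powr (r - 1)) else 0) \<partial>lborel)
        = ennreal (t powr (r - 1)) * indicator {0<..} t * (\<integral>\<^sup>+ x. indicator {x. ennreal t < hl_max u x} x \<partial>lborel)"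
        by (subst nn_integral_cmult[symmetric]) (auto split: split_indicator intro!: nn_integral_cong)
      also have "\<dots> = ennreal (t powr (r - 1)) * indicator {0<..} t * emeasure lborel {x. ennreal t < hl_max u x}"
        by simp
      also have "\<dots> \<le> ennreal (t powr (r - 1)) * indicator {0<..} t * (ennreal (A / t) * (\<integral>\<^sup>+ x. v t x \<partial>lborel))"
        using level[of t] by (cases "t > 0") (auto intro!: mult_left_mono)
      finally show "(\<integral>\<^sup>+ x. (if 0 < t \<and> ennreal t < hl_max u x then ennreal (t powr (r - 1)) else 0) \<partial>lborel)
        \<le> (\<integral>\<^sup>+ x. ennreal (t powr (r - 1)) * indicator {0<..} t * (ennreal (A / t) * v t x) \<partial>lborel)"
        by (simp add: nn_integral_cmult)
    qed auto
    also have "\<dots> = ennreal r * (\<integral>\<^sup>+ x. \<integral>\<^sup>+ t. ennreal (t powr (r - 1)) * indicator {0<..} t * (ennreal (A / t) * v t x) \<partial>lborel \<partial>lborel)"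
      unfolding v_def by (intro arg_cong2[where f = "(*)"] refl lborel_pair.Fubini'[symmetric]) measurable
    also have "\<dots> = ennreal r * (\<integral>\<^sup>+ x. ennreal (A * ((2 * V) powr (r - 1) / (r - 1))) * ennreal (u x powr r) \<partial>lborel)"
    proof (intro arg_cong2[where f = "(*)"] nn_integral_cong refl)
      fix x
      have "(\<integral>\<^sup>+ t. ennreal (t powr (r - 1)) * indicator {0<..} t * (ennreal (A / t) * v t x) \<partial>lborel)
        = (\<integral>\<^sup>+ t. ennreal (A * u x) * (ennreal (t powr (r - 2)) * indicator {0<..<2 * V * u x} t) \<partial>lborel)"
      proof (intro nn_integral_cong)
        fix t :: real
        have "t powr (r - 1) / t = t powr (r - 2)" if "t > 0"
          using that powr_diff[of t "r - 1" 1] by simp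
        then have *: "t powr (r - 1) * (A / t * u x) = A * u x * t powr (r - 2)" if "t > 0"
          using that by (simp add: field_simps)
        show "ennreal (t powr (r - 1)) * indicator {0<..} t * (ennreal (A / t) * v t x)
          = ennreal (A * u x) * (ennreal (t powr (r - 2)) * indicator {0<..<2 * V * u x} t)"
          using * A V u[of x] by (auto simp: v_def ennreal_mult[symmetric] field_simps split: split_indicator)
      qed
      also have "\<dots> = ennreal (A * u x) * ennreal ((2 * V * u x) powr (r - 1) / (r - 1))"
        using r V u[of x] nn_integral_powr_from_0[of "r - 2" "2 * V * u x"] by (simp add: nn_integral_cmult)
      also have "\<dots> = ennreal (A * ((2 * V) powr (r - 1) / (r - 1))) * ennreal (u x powr r)"
      proof -
        have "u x * u x powr (r - 1) = u x powr r"
          using u[of x] r by (cases "u x = 0") (auto simp: powr_diff)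
        then show ?thesis
          using u[of x] r A V by (simp add: ennreal_mult[symmetric] powr_mult field_simps)
      qed
      finally show "(\<integral>\<^sup>+ t. ennreal (t powr (r - 1)) * indicator {0<..} t * (ennreal (A / t) * v t x) \<partial>lborel)
        = ennreal (A * ((2 * V) powr (r - 1) / (r - 1))) * ennreal (u x powr r)" .
    qed
    also have "\<dots> = ennreal C * (\<integral>\<^sup>+ x. ennreal (u x powr r) \<partial>lborel)"
      using r A V by (subst nn_integral_cmult) (simp_all add: C_def mult.assoc[symmetric] ennreal_mult[symmetric])
    finally show ?thesis .
  qed
  ultimately show ?thesis by blast
qed

section \<open>Test functions of product form\<close>

primrec Cdiff :: "nat \<Rightarrow> (real \<Rightarrow> real) \<Rightarrow> bool" where
  "Cdiff 0 u \<longleftrightarrow> True"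
| "Cdiff (Suc k) u \<longleftrightarrow> (\<forall>x. u field_differentiable at x) \<and> Cdiff k (deriv u)"

definition smooth :: "(real \<Rightarrow> real) \<Rightarrow> bool" where
  "smooth u \<longleftrightarrow> (\<forall>k. Cdiff k u)"

lemma Cdiff_SucI:
  assumes "\<And>x. (u has_real_derivative u' x) (at x)" "Cdiff k u'"
  shows "Cdiff (Suc k) u"
proof -
  have "deriv u = u'"
    using assms(1) by (auto intro: DERIV_imp_deriv)
  then show ?thesis
    using assms by (auto simp: field_differentiable_def)
qed

lemma Cdiff_SucD: "Cdiff (Suc k) u \<Longrightarrow> Cdiff k u"
  by (induction k arbitrary: u) auto

lemma Cdiff_const: "Cdiff k (\<lambda>x. c)"
proof (induction k arbitrary: c)
  case (Suc k)
  show ?case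
    by (rule Cdiff_SucI[OF DERIV_const Suc.IH])
qed simp

lemma Cdiff_ident: "Cdiff k (\<lambda>x. x)"
proof (cases k)
  case (Suc l)
  then show ?thesis
    using Cdiff_SucI[OF DERIV_ident Cdiff_const] by (simp only:)
qed simp

lemma Cdiff_add: "Cdiff k u \<Longrightarrow> Cdiff k v \<Longrightarrow> Cdiff k (\<lambda>x. u x + v x)"
proof (induction k arbitrary: u v)
  case (Suc k)
  then show ?case
    by (intro Cdiff_SucI[where u' = "\<lambda>x. deriv u x + deriv v x"] DERIV_add)
      (auto simp: field_differentiable_derivI)
qed simp

lemma Cdiff_mult: "Cdiff k u \<Longrightarrow> Cdiff k v \<Longrightarrow> Cdiff k (\<lambda>x. u x * v x)"
proof (induction k arbitrary: u v)
  case (Suc k)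
  have "((\<lambda>x. u x * v x) has_real_derivative deriv u x * v x + u x * deriv v x) (at x)" for x
    using Suc.prems by (auto intro!: derivative_eq_intros field_differentiable_derivI)
  moreover have "Cdiff k (\<lambda>x. deriv u x * v x + u x * deriv v x)"
    using Suc.prems Cdiff_SucD[OF Suc.prems(1)] Cdiff_SucD[OF Suc.prems(2)]
    by (intro Cdiff_add Suc.IH) auto
  ultimately show ?case by (rule Cdiff_SucI)
qed simp

lemma Cdiff_affine: "Cdiff k u \<Longrightarrow> Cdiff k (\<lambda>x. u (a * x + b))"
proof (induction k arbitrary: u)
  case (Suc k)
  have "((\<lambda>x. u (a * x + b)) has_real_derivative deriv u (a * x + b) * a) (at x)" for x
    using Suc.prems
    by (intro DERIV_chain2[where f = u and g = "\<lambda>x. a * x + b"] field_differentiable_derivI)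
      (auto intro!: derivative_eq_intros)
  moreover have "Cdiff k (\<lambda>x. deriv u (a * x + b) * a)"
    using Suc.prems by (intro Cdiff_mult[OF Suc.IH Cdiff_const]) auto
  ultimately show ?case by (rule Cdiff_SucI)
qed simp

lemma smooth_const: "smooth (\<lambda>x. c)"
  and smooth_ident: "smooth (\<lambda>x. x)"
  and smooth_mult: "smooth u \<Longrightarrow> smooth v \<Longrightarrow> smooth (\<lambda>x. u x * v x)"
  and smooth_affine: "smooth u \<Longrightarrow> smooth (\<lambda>x. u (a * x + b))"
  by (simp_all add: smooth_def Cdiff_const Cdiff_ident Cdiff_mult Cdiff_affine)

lemma smooth_power: "smooth (\<lambda>x. x ^ k)"
  by (induction k) (simp_all add: smooth_const smooth_mult smooth_ident)

lemma smooth_deriv: "smooth u \<Longrightarrow> smooth (deriv u)"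
proof -
  assume "smooth u"
  then have "Cdiff (Suc k) u" for k by (simp only: smooth_def)
  then show ?thesis by (simp add: smooth_def)
qed

lemma smooth_DERIV: "smooth u \<Longrightarrow> (u has_real_derivative deriv u x) (at x)"
proof -
  assume "smooth u"
  then have "Cdiff (Suc 0) u" by (simp only: smooth_def)
  then show ?thesis by (simp add: field_differentiable_derivI)
qed

lemma smooth_continuous_on: "smooth u \<Longrightarrow> continuous_on S u"
  by (intro continuous_at_imp_continuous_on ballI DERIV_isCont[OF smooth_DERIV])

definition flat_exp :: "real poly \<Rightarrow> real \<Rightarrow> real" where
  "flat_exp q t = (if t > 0 then poly q (1 / t) * exp (- (1 / t)) else 0)"

lemma tendsto_poly_div_exp: "((\<lambda>y. poly q y * exp (- y)) \<longlongrightarrow> (0::real)) at_top"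
proof -
  have "((\<lambda>y. \<Sum>i\<le>degree q. coeff q i * (y ^ i / exp y)) \<longlongrightarrow> (\<Sum>i\<le>degree q. coeff q i * 0)) at_top"
    by (intro tendsto_intros tendsto_power_div_exp_0)
  then show ?thesis
    by (simp add: poly_altdef exp_minus sum_distrib_right divide_inverse mult.assoc)
qed

lemma flat_exp_DERIV:
  "(flat_exp q has_real_derivative flat_exp ([:0, 0, 1:] * (q - pderiv q)) t) (at t)"
proof -
  consider "t > 0" | "t < 0" | "t = 0" by linarith
  then show ?thesis
  proof cases
    case 1
    have "((\<lambda>t. poly q (1 / t) * exp (- (1 / t))) has_real_derivative
        flat_exp ([:0, 0, 1:] * (q - pderiv q)) t) (at t)"
      using 1 by (auto intro!: derivative_eq_intros DERIV_chain2[OF poly_DERIV]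
          simp: flat_exp_def field_simps power2_eq_square)
    then show ?thesis
      by (rule has_field_derivative_transform_within_open[of _ _ _ "{0<..}"])
        (use 1 in \<open>auto simp: flat_exp_def\<close>)
  next
    case 2
    have "((\<lambda>t. 0) has_real_derivative flat_exp ([:0, 0, 1:] * (q - pderiv q)) t) (at t)"
      using 2 by (auto simp: flat_exp_def)
    then show ?thesis
      by (rule has_field_derivative_transform_within_open[of _ _ _ "{..<0}"])
        (use 2 in \<open>auto simp: flat_exp_def\<close>)
  next
    case 3
    have "((\<lambda>h. poly (pCons 0 q) (inverse h) * exp (- inverse h)) \<longlongrightarrow> 0) (at_right (0::real))"
      by (rule filterlim_compose[OF tendsto_poly_div_exp filterlim_inverse_at_top_right])
    then have "((\<lambda>h. (flat_exp q h - flat_exp q 0) / h) \<longlongrightarrow> 0) (at_right 0)"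
      by (rule Lim_transform_eventually)
        (auto simp: flat_exp_def eventually_at_filter field_simps)
    moreover have "((\<lambda>h. (flat_exp q h - flat_exp q 0) / h) \<longlongrightarrow> 0) (at_left 0)"
      by (rule tendsto_eventually) (auto simp: flat_exp_def eventually_at_filter)
    ultimately have "((\<lambda>h. (flat_exp q h - flat_exp q 0) / h) \<longlongrightarrow> 0) (at 0)"
      by (simp add: filterlim_split_at)
    then show ?thesis
      using 3 by (simp add: has_field_derivative_iff flat_exp_def)
  qed
qed

lemma smooth_flat_exp: "smooth (flat_exp q)"
proof -
  have "Cdiff k (flat_exp q)" for k q
  proof (induction k arbitrary: q)
    case (Suc k)
    show ?case
      by (rule Cdiff_SucI[OF flat_exp_DERIV Suc.IH])
  qed simp
  then show ?thesis by (simp add: smooth_def)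
qed

definition bump :: "real \<Rightarrow> real" where
  "bump t = flat_exp 1 (1 * t + 1) * flat_exp 1 ((- 1) * t + 1)"

lemma smooth_bump: "smooth bump"
  unfolding bump_def by (intro smooth_mult[OF smooth_affine smooth_affine] smooth_flat_exp)

lemma bump_eq_0: "\<bar>t\<bar> > 1 \<Longrightarrow> bump t = 0"
  by (auto simp: bump_def flat_exp_def)

lemma bump_nonneg: "bump t \<ge> 0" and bump_0_pos: "bump 0 > 0"
  by (auto simp: bump_def flat_exp_def)

definition tensor :: "('n::finite \<Rightarrow> real \<Rightarrow> real) \<Rightarrow> real^'n \<Rightarrow> real" where
  "tensor u x = (\<Prod>i\<in>UNIV. u i (x $ i))"

definition admissible :: "('n::finite \<Rightarrow> real \<Rightarrow> real) \<Rightarrow> bool" where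
  "admissible u \<longleftrightarrow> (\<forall>i. smooth (u i) \<and> (\<exists>R. \<forall>t. \<bar>t\<bar> > R \<longrightarrow> u i t = 0))"

lemma admissible_smooth: "admissible u \<Longrightarrow> smooth (u i)"
  by (simp add: admissible_def)

lemma admissible_bound:
  assumes "admissible u"
  obtains R where "R > 0" "\<And>i t. \<bar>t\<bar> > R \<Longrightarrow> u i t = 0"
proof -
  obtain R where R: "\<And>i t. \<bar>t\<bar> > R i \<Longrightarrow> u i t = 0"
    using assms unfolding admissible_def by metis
  have "\<bar>t\<bar> > R i" if "\<bar>t\<bar> > 1 + (\<Sum>i\<in>UNIV. \<bar>R i\<bar>)" for i t
    using that member_le_sum[of i UNIV "\<lambda>i. \<bar>R i\<bar>"] by simp
  then show ?thesis
    using R by (intro that[of "1 + (\<Sum>i\<in>UNIV. \<bar>R i\<bar>)"]) (auto intro: add_pos_nonneg sum_nonneg)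
qed

lemma tensor_fun_upd: "tensor (u(i := v)) x = v (x $ i) * (\<Prod>l\<in>UNIV - {i}. u l (x $ l))"
  unfolding tensor_def by (subst prod.remove[of _ i]) auto

lemma tensor_split: "tensor u x = u i (x $ i) * (\<Prod>l\<in>UNIV - {i}. u l (x $ l))"
  unfolding tensor_def by (subst prod.remove[of _ i]) auto

lemma tensor_DERIV:
  assumes "admissible u"
  shows "((\<lambda>t. tensor u (x + t *\<^sub>R axis i 1)) has_real_derivative
    tensor (u(i := deriv (u i))) x) (at 0)"
proof -
  have "tensor u (x + t *\<^sub>R axis i 1) = u i (x $ i + t) * (\<Prod>l\<in>UNIV - {i}. u l (x $ l))" for t
    unfolding tensor_split[of _ _ i] by (auto simp: axis_def intro!: prod.cong)
  moreover have "((\<lambda>t. u i (x $ i + t) * (\<Prod>l\<in>UNIV - {i}. u l (x $ l))) has_real_derivative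
      deriv (u i) (x $ i) * (\<Prod>l\<in>UNIV - {i}. u l (x $ l))) (at 0)"
    using smooth_DERIV[OF admissible_smooth[OF assms], of i "x $ i"]
    by (intro DERIV_cmult_right) (simp add: DERIV_shift[of "u i" _ 0 "x $ i", symmetric] add.commute[of "x $ i"])
  ultimately show ?thesis
    by (simp add: tensor_fun_upd)
qed

lemma pdiff_tensor: "admissible u \<Longrightarrow> pdiff i (tensor u) = tensor (u(i := deriv (u i)))"
  unfolding pdiff_def by (rule ext, rule DERIV_imp_deriv, rule tensor_DERIV)

lemma deriv_eq_0_outside:
  assumes "\<And>t. \<bar>t\<bar> > R \<Longrightarrow> u t = (0::real)" "\<bar>t\<bar> > R"
  shows "deriv u t = 0"
proof -
  have "open {t::real. \<bar>t\<bar> > R}"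
    by (intro open_Collect_less continuous_intros)
  then have "(u has_real_derivative 0) (at t)"
    using assms by (intro has_field_derivative_transform_within_open[of "\<lambda>_. 0" 0 t "{t. \<bar>t\<bar> > R}" u]) auto
  then show ?thesis by (rule DERIV_imp_deriv)
qed

lemma admissible_fun_upd:
  assumes "admissible u" "smooth v" "\<And>t. \<bar>t\<bar> > R \<Longrightarrow> v t = 0"
  shows "admissible (u(i := v))"
  using assms by (auto simp: admissible_def)

lemma admissible_deriv:
  assumes "admissible u" shows "admissible (u(i := deriv (u i)))"
proof -
  obtain R where "\<And>i t. \<bar>t\<bar> > R \<Longrightarrow> u i t = 0"
    using assms by (rule admissible_bound) blast
  then have "\<And>t. \<bar>t\<bar> > R \<Longrightarrow> deriv (u i) t = 0"
    by (intro deriv_eq_0_outside) blast+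
  then show ?thesis
    using assms by (intro admissible_fun_upd[of u _ R] smooth_deriv admissible_smooth)
qed

lemma pdiffs_tensor:
  assumes "admissible u"
  shows "admissible (\<lambda>i. (deriv ^^ count_list is i) (u i)) \<and>
    pdiffs is (tensor u) = tensor (\<lambda>i. (deriv ^^ count_list is i) (u i))"
proof (induction "is")
  case Nil
  then show ?case using assms by simp
next
  case (Cons a xs)
  let ?v = "\<lambda>i. (deriv ^^ count_list xs i) (u i)"
  have "(\<lambda>i. (deriv ^^ count_list (a # xs) i) (u i)) = ?v(a := deriv (?v a))"
    by auto
  then show ?case
    using Cons pdiff_tensor[of ?v a] admissible_deriv[of ?v a] by simp
qed

lemma continuous_on_tensor: "admissible u \<Longrightarrow> continuous_on S (tensor u)"
  unfolding tensor_def
  by (rule continuous_on_prod, rule continuous_on_compose2[OF smooth_continuous_on[of _ UNIV]])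
    (auto intro: admissible_smooth continuous_intros)

lemma tensor_eq_0:
  assumes "\<And>i t. \<bar>t\<bar> > R \<Longrightarrow> u i t = 0" "\<bar>x $ i\<bar> > R"
  shows "tensor u x = 0"
  unfolding tensor_def using assms(1)[OF assms(2)] by (intro prod_zero) auto

lemma test_fun_tensor:
  assumes "admissible u"
  shows "test_fun (tensor u)"
  unfolding test_fun_def
proof (intro conjI allI)
  fix "is"
  show "continuous_on UNIV (pdiffs is (tensor u))"
    using pdiffs_tensor[OF assms] by (auto intro: continuous_on_tensor)
  show "(\<lambda>t. pdiffs is (tensor u) (x + t *\<^sub>R axis i 1)) differentiable at 0" for i x
    using pdiffs_tensor[OF assms, of "is"] tensor_DERIV
    by (auto simp: real_differentiable_def)
next
  obtain R where R: "R > 0" "\<And>i t. \<bar>t\<bar> > R \<Longrightarrow> u i t = 0"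
    using assms by (rule admissible_bound) blast
  have "{x. tensor u x \<noteq> 0} \<subseteq> cbox (\<chi> i. - R) (\<chi> i. R)"
  proof
    fix x assume "x \<in> {x. tensor u x \<noteq> 0}"
    then have "\<not> R < \<bar>x $ i\<bar>" for i
      using tensor_eq_0[of R u x i] R(2) by auto
    then show "x \<in> cbox (\<chi> i. - R) (\<chi> i. R)"
      by (simp add: mem_box_cart abs_le_iff not_less minus_le_iff)
  qed
  then show "compact (closure {x. tensor u x \<noteq> 0})"
    by (meson bounded_cbox bounded_subset compact_closure)
qed

lemma count_list_mi_list: "count_list (mi_list \<alpha>) i = \<alpha> i"
proof -
  have ex: "\<exists>xs::'a list. distinct xs \<and> set xs = UNIV"
    using finite_distinct_list[of "UNIV :: 'a set"] by auto
  have c: "distinct (coord_list :: 'a list)" "set (coord_list :: 'a list) = UNIV"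
    using someI_ex[OF ex] by (simp_all add: coord_list_def)
  have "count_list (replicate k a) i = (if a = i then k else 0)" for k and a :: 'a
    by (induction k) auto
  then have "count_list (concat (map (\<lambda>i. replicate (\<alpha> i) i) xs)) i = (if i \<in> set xs then \<alpha> i else 0)"
    if "distinct xs" for xs
    using that by (induction xs) auto
  then show ?thesis
    using c by (simp add: mi_list_def)
qed

lemma Dcl_tensor: "admissible u \<Longrightarrow> Dcl \<alpha> (tensor u) = tensor (\<lambda>i. (deriv ^^ \<alpha> i) (u i))"
  using pdiffs_tensor[of u "mi_list \<alpha>"] by (simp add: Dcl_def count_list_mi_list)

abbreviation mi_Suc :: "('n \<Rightarrow> nat) \<Rightarrow> 'n \<Rightarrow> 'n \<Rightarrow> nat" where
  "mi_Suc j i \<equiv> j(i := Suc (j i))"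

lemma mi_abs_mi_Suc: "mi_abs (mi_Suc j i) = Suc (mi_abs j)"
proof -
  have "mi_abs j = j i + sum j (UNIV - {i})" for j :: "'a \<Rightarrow> nat"
    unfolding mi_abs_def by (rule sum.remove) auto
  then show ?thesis by simp
qed

lemma Dcl_deriv_tensor:
  assumes "admissible u"
  shows "Dcl j (tensor (u(i := deriv (u i)))) = Dcl (mi_Suc j i) (tensor u)"
proof -
  have "(\<lambda>l. (deriv ^^ j l) ((u(i := deriv (u i))) l)) = (\<lambda>l. (deriv ^^ (mi_Suc j i) l) (u l))"
    by (auto simp: funpow_swap1)
  then show ?thesis
    using assms by (simp add: Dcl_tensor admissible_deriv)
qed

lemma weak_deriv_step:
  assumes "weak_deriv j F g" "weak_deriv (mi_Suc j i) F h" "admissible u"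
  shows "(\<integral>x. g x * tensor (u(i := deriv (u i))) x \<partial>lborel) = - (\<integral>x. h x * tensor u x \<partial>lborel)"
proof -
  have "(-1) ^ mi_abs j * (\<integral>x. g x * tensor (u(i := deriv (u i))) x \<partial>lborel)
      = (\<integral>x. F x * Dcl j (tensor (u(i := deriv (u i)))) x \<partial>lborel)"
    using assms test_fun_tensor[OF admissible_deriv[OF assms(3)]] by (simp add: weak_deriv_def)
  also have "\<dots> = (-1) ^ mi_abs (mi_Suc j i) * (\<integral>x. h x * tensor u x \<partial>lborel)"
    using assms test_fun_tensor[OF assms(3)] by (simp add: weak_deriv_def Dcl_deriv_tensor)
  finally have "(-1) ^ mi_abs j * (\<integral>x. g x * tensor (u(i := deriv (u i))) x \<partial>lborel)
      = (-1) ^ mi_abs j * (- (\<integral>x. h x * tensor u x \<partial>lborel))"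
    by (simp add: mi_abs_mi_Suc)
  then show ?thesis
    by (subst (asm) mult_left_cancel) auto
qed

section \<open>Averages over shrinking scales\<close>

lemma lborel_integral_affine:
  fixes f :: "'a::euclidean_space \<Rightarrow> real"
  assumes [measurable]: "f \<in> borel_measurable borel" and "s > 0"
  shows "(\<integral>w. f w \<partial>lborel) = s ^ DIM('a) * (\<integral>z. f (c + s *\<^sub>R z) \<partial>lborel)"
proof -
  have "(\<integral>w. f w \<partial>lborel) =
      (\<integral>w. f w \<partial>density (distr lborel borel (\<lambda>x. c + s *\<^sub>R x)) (\<lambda>_. ennreal (\<bar>s\<bar> ^ DIM('a))))"
    using lborel_affine[of s c] assms(2) by simp
  also have "\<dots> = (\<integral>z. \<bar>s\<bar> ^ DIM('a) * f (c + s *\<^sub>R z) \<partial>lborel)"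
    by (subst integral_density) (auto simp: integral_distr)
  finally show ?thesis
    using assms(2) by simp
qed

lemma lborel_nn_integral_affine:
  fixes f :: "'a::euclidean_space \<Rightarrow> ennreal"
  assumes [measurable]: "f \<in> borel_measurable borel" and "s > 0"
  shows "(\<integral>\<^sup>+ w. f w \<partial>lborel) = ennreal (s ^ DIM('a)) * (\<integral>\<^sup>+ z. f (c + s *\<^sub>R z) \<partial>lborel)"
proof -
  have "(\<integral>\<^sup>+ w. f w \<partial>lborel) =
      (\<integral>\<^sup>+ w. f w \<partial>density (distr lborel borel (\<lambda>x. c + s *\<^sub>R x)) (\<lambda>_. ennreal (\<bar>s\<bar> ^ DIM('a))))"
    using lborel_affine[of s c] assms(2) by simp
  also have "\<dots> = (\<integral>\<^sup>+ z. ennreal (\<bar>s\<bar> ^ DIM('a)) * f (c + s *\<^sub>R z) \<partial>lborel)"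
    by (subst nn_integral_density) (auto simp: nn_integral_distr)
  finally show ?thesis
    using assms(2) by (simp add: nn_integral_cmult)
qed

lemma continuous_support_integral:
  fixes f :: "'a::euclidean_space \<Rightarrow> real"
  assumes "continuous_on UNIV f" "\<And>x. x \<notin> cbox a b \<Longrightarrow> f x = 0"
  shows "integrable lborel f" "(\<integral>x. f x \<partial>lborel) = integral (cbox a b) f"
proof -
  have eq: "(\<lambda>x. indicator (cbox a b) x *\<^sub>R f x) = f"
    using assms(2) by (auto simp: indicator_def fun_eq_iff)
  have "set_integrable lborel (cbox a b) f"
    unfolding set_integrable_def
    by (rule borel_integrable_compact[OF compact_cbox continuous_on_subset[OF assms(1)]]) auto
  then show "integrable lborel f" "(\<integral>x. f x \<partial>lborel) = integral (cbox a b) f"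
    using set_borel_integral_eq_integral(2)[of "cbox a b" f] eq
    by (auto simp: set_integrable_def set_lebesgue_integral_def)
qed

lemma tensor_notin_cbox:
  assumes "\<And>i t. \<bar>t - c $ i\<bar> > R \<Longrightarrow> u i t = 0" "x \<notin> cbox (c - (\<chi> i. R)) (c + (\<chi> i. R))"
  shows "tensor u x = 0"
proof -
  obtain i where "\<bar>x $ i - c $ i\<bar> > R"
  proof -
    have "\<not> (\<forall>i. \<bar>x $ i - c $ i\<bar> \<le> R)"
      using assms(2) unfolding mem_box_cart abs_le_iff by (auto simp: algebra_simps)
    then show ?thesis
      using that by (auto simp: not_le)
  qed
  then have "u i (x $ i) = 0"
    by (rule assms(1))
  then show ?thesis
    unfolding tensor_def by (intro prod_zero) auto
qed

lemma integrable_continuous_tensor: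
  assumes "continuous_on UNIV g" "admissible u"
  shows "integrable lborel (\<lambda>x. g x * tensor u x)"
proof -
  obtain R where "\<And>i t. \<bar>t\<bar> > R \<Longrightarrow> u i t = 0"
    using assms(2) by (rule admissible_bound) blast
  then show ?thesis
    using tensor_notin_cbox[of R 0 u]
    by (intro continuous_support_integral(1)[of _ "0 - (\<chi> i. R)" "0 + (\<chi> i. R)"] continuous_on_mult
        assms(1) continuous_on_tensor[OF assms(2)]) auto
qed

lemma scale_average_continuous:
  assumes "continuous_on UNIV g" "admissible u"
  shows "continuous_on UNIV (\<lambda>s. \<integral>z. g (c + s *\<^sub>R z) * tensor u z \<partial>lborel)"
proof -
  obtain R where R: "\<And>i t. \<bar>t\<bar> > R \<Longrightarrow> u i t = 0"
    using assms(2) by (rule admissible_bound) blast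
  let ?a = "0 - (\<chi> i. R) :: real^'a" and ?b = "0 + (\<chi> i. R) :: real^'a"
  have cont: "continuous_on UNIV (\<lambda>(s, z). g (c + s *\<^sub>R z) * tensor u z)"
    unfolding case_prod_beta
    by (intro continuous_on_mult continuous_on_compose2[OF assms(1)]
        continuous_on_compose2[OF continuous_on_tensor[OF assms(2), of UNIV]] continuous_intros) auto
  have "(\<integral>z. g (c + s *\<^sub>R z) * tensor u z \<partial>lborel) = integral (cbox ?a ?b) (\<lambda>z. g (c + s *\<^sub>R z) * tensor u z)" for s
    using tensor_notin_cbox[of R 0 u] R
    by (intro continuous_support_integral(2) continuous_on_mult continuous_on_compose2[OF assms(1)]
        continuous_on_tensor[OF assms(2)] continuous_intros) auto
  then show ?thesis
    using integral_continuous_on_param[OF continuous_on_subset[OF cont], of UNIV ?a ?b] by simp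
qed

text \<open>In the variable \<open>w = c + s z\<close> the average is \<open>\<integral> g(w) s\<^sup>-\<^sup>n \<psi>((w - c)/s) dw\<close>, and the kernel
  satisfies the continuity equation
  \<open>\<partial>\<^sub>s [s\<^sup>-\<^sup>n \<psi>((w - c)/s)] = - div\<^sub>w [((w - c)/s) s\<^sup>-\<^sup>n \<psi>((w - c)/s)]\<close>; the divergence is moved to \<open>g\<close>
  by the weak derivative. For a kernel of product form this reduces to one variable.\<close>

lemma scale_average_DERIV:
  fixes g :: "real^'n::finite \<Rightarrow> real" and h :: "'n \<Rightarrow> real^'n \<Rightarrow> real"
  assumes g: "continuous_on UNIV g" and h [measurable]: "\<And>i. h i \<in> borel_measurable borel"
    and weak: "\<And>i u. admissible u \<Longrightarrow>
      (\<integral>x. g x * tensor (u(i := deriv (u i))) x \<partial>lborel) = - (\<integral>x. h i x * tensor u x \<partial>lborel)"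
    and u: "admissible u" and s: "s > 0"
  shows "((\<lambda>s. \<integral>z. g (c + s *\<^sub>R z) * tensor u z \<partial>lborel) has_real_derivative
    (\<Sum>i\<in>UNIV. \<integral>z. h i (c + s *\<^sub>R z) * (z $ i * tensor u z) \<partial>lborel)) (at s)"
proof -
  obtain R where R: "R > 0" "\<And>i t. \<bar>t\<bar> > R \<Longrightarrow> u i t = 0"
    using u by (rule admissible_bound) blast
  have R': "deriv (u i) t = 0" if "\<bar>t\<bar> > R" for i t
    by (rule deriv_eq_0_outside[OF R(2) that])
  note [measurable] = borel_measurable_continuous_onI[OF g]
  define k where "k = (\<lambda>s i t. u i ((t - c $ i) / s) / s)"
  define q where "q = (\<lambda>s i t. ((t - c $ i) / s) * u i ((t - c $ i) / s) / s)"
  define k' where "k' = (\<lambda>s i t. - (u i ((t - c $ i) / s) + (t - c $ i) / s * deriv (u i) ((t - c $ i) / s)) / s\<^sup>2)"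
  define U where "U = {s / 2<..<2 * s}"
  have sU: "s \<in> U" and U: "\<And>s'. s' \<in> U \<Longrightarrow> 0 < s' \<and> s' < 2 * s"
    using s by (auto simp: U_def)
  have far: "\<bar>(t - c $ i) / s'\<bar> > R" if "\<bar>t - c $ i\<bar> > 2 * s * R" "s' \<in> U" for t i s'
  proof -
    have "s' * R \<le> 2 * s * R"
      using U[OF that(2)] R(1) by (intro mult_right_mono) auto
    then show ?thesis
      using that(1) U[OF that(2)] by (simp add: abs_divide pos_less_divide_eq mult.commute)
  qed
  have k_0: "k s' i t = 0" and q_0: "q s' i t = 0" and k'_0: "k' s' i t = 0"
    if "\<bar>t - c $ i\<bar> > 2 * s * R" "s' \<in> U" for s' i t
    using far[OF that] R(2) R' by (auto simp: k_def q_def k'_def)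
  have smooth_k: "smooth (k s' i)" and smooth_q: "smooth (q s' i)" for s' i
  proof -
    have u': "smooth (\<lambda>t. u i ((1 / s') * t + (- c $ i / s')))"
      by (rule smooth_affine[OF admissible_smooth[OF u]])
    have "smooth (\<lambda>t. u i ((1 / s') * t + (- c $ i / s')) * (1 / s'))"
      by (rule smooth_mult[OF u' smooth_const])
    moreover have "smooth (\<lambda>t. (1 / s') * t + (- c $ i / s'))"
      by (rule smooth_affine[OF smooth_ident])
    ultimately have "smooth (\<lambda>t. ((1 / s') * t + (- c $ i / s')) * (u i ((1 / s') * t + (- c $ i / s')) * (1 / s')))"
      by (rule smooth_mult[rotated])
    with \<open>smooth (\<lambda>t. u i ((1 / s') * t + (- c $ i / s')) * (1 / s'))\<close>
    show "smooth (k s' i)" "smooth (q s' i)"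
      by (simp_all add: k_def q_def diff_divide_distrib)
  qed
  have bound: "\<bar>t - c $ i\<bar> > 2 * s * R" if "\<bar>t\<bar> > 2 * s * R + norm c" for t i
    using that component_le_norm_cart[of c i] by linarith
  have adm_k: "admissible (k s')" if "s' \<in> U" for s'
    unfolding admissible_def
    by (intro allI conjI smooth_k exI[of _ "2 * s * R + norm c"] impI k_0[OF bound that])
  have adm_q: "admissible ((k s)(i := q s i))" for i
    by (rule admissible_fun_upd[OF adm_k[OF sU] smooth_q q_0[OF bound sU]])
  have DERIV_k: "((\<lambda>s'. k s' i t) has_real_derivative k' s' i t) (at s')" if "s' \<in> U" for s' i t
  proof -
    have "((\<lambda>s'. u i ((t - c $ i) / s')) has_real_derivative
        deriv (u i) ((t - c $ i) / s') * (- (t - c $ i) / s'\<^sup>2)) (at s')"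
      using U[OF that]
      by (intro DERIV_chain2[where f = "u i"] smooth_DERIV admissible_smooth[OF u])
        (auto intro!: derivative_eq_intros simp: power2_eq_square)
    then have "((\<lambda>s'. u i ((t - c $ i) / s') / s') has_real_derivative
        (deriv (u i) ((t - c $ i) / s') * (- (t - c $ i) / s'\<^sup>2) * s' - u i ((t - c $ i) / s') * 1) / (s' * s')) (at s')"
      using U[OF that] by (intro DERIV_divide DERIV_ident) auto
    moreover have "(deriv (u i) ((t - c $ i) / s') * (- (t - c $ i) / s'\<^sup>2) * s' - u i ((t - c $ i) / s') * 1) / (s' * s') = k' s' i t"
      using U[OF that] by (simp add: k'_def field_simps power2_eq_square)
    ultimately show ?thesis by (simp add: k_def)
  qed
  have deriv_q: "deriv (q s i) t = - k' s i t" for i t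
  proof -
    have "((\<lambda>t. u i ((t - c $ i) / s)) has_real_derivative deriv (u i) ((t - c $ i) / s) * (1 / s)) (at t)"
      using s by (intro DERIV_chain2[where f = "u i"] smooth_DERIV admissible_smooth[OF u])
        (auto intro!: derivative_eq_intros)
    then have "(q s i has_real_derivative
       (((1 / s) * u i ((t - c $ i) / s) + deriv (u i) ((t - c $ i) / s) * (1 / s) * ((t - c $ i) / s)) / s)) (at t)"
      unfolding q_def using s by (auto intro!: derivative_eq_intros simp: add_divide_distrib)
    then show ?thesis
      using s by (simp add: DERIV_imp_deriv k'_def field_simps power2_eq_square)
  qed
  define fx where "fx = (\<lambda>s w. g w * (\<Sum>i\<in>UNIV. k' s i (w $ i) * (\<Prod>l\<in>UNIV - {i}. k s l (w $ l))))"
  let ?a = "c - (\<chi> i. 2 * s * R)" and ?b = "c + (\<chi> i. 2 * s * R)"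
  have subst: "(\<integral>z. g (c + s' *\<^sub>R z) * tensor u z \<partial>lborel) = integral (cbox ?a ?b) (\<lambda>w. g w * tensor (k s') w)"
    if s': "s' \<in> U" for s'
  proof -
    have "tensor (k s') (c + s' *\<^sub>R z) = tensor u z / s' ^ CARD('n)" for z
      using U[OF s'] by (simp add: tensor_def k_def prod_dividef)
    then have "(\<integral>z. g (c + s' *\<^sub>R z) * tensor u z \<partial>lborel) = (\<integral>w. g w * tensor (k s') w \<partial>lborel)"
      using U[OF s'] borel_measurable_continuous_onI[OF continuous_on_tensor[OF adm_k[OF s']]]
      by (subst lborel_integral_affine[of _ s' c]) (auto simp: mult.assoc[symmetric])
    also have "\<dots> = integral (cbox ?a ?b) (\<lambda>w. g w * tensor (k s') w)"
    proof (rule continuous_support_integral)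
      show "continuous_on UNIV (\<lambda>w. g w * tensor (k s') w)"
        by (intro continuous_on_mult g continuous_on_tensor adm_k s')
      show "g x * tensor (k s') x = 0" if "x \<notin> cbox ?a ?b" for x
        using tensor_notin_cbox[OF k_0[OF _ s'] that] by simp
    qed
    finally show ?thesis .
  qed
  have "((\<lambda>s'. integral (cbox ?a ?b) (\<lambda>w. g w * tensor (k s') w)) has_real_derivative
      integral (cbox ?a ?b) (fx s)) (at s within U)"
  proof (rule leibniz_rule_field_derivative)
    show "((\<lambda>s'. g w * tensor (k s') w) has_real_derivative fx s' w) (at s' within U)" if "s' \<in> U" for s' w
      unfolding fx_def tensor_def
      by (rule has_field_derivative_at_within, rule DERIV_cmult, rule has_field_derivative_prod)
        (rule DERIV_k[OF that])
    show "(\<lambda>w. g w * tensor (k s') w) integrable_on cbox ?a ?b" if "s' \<in> U" for s'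
      by (intro integrable_continuous continuous_on_mult continuous_on_tensor adm_k that
          continuous_on_subset[OF g]) auto
    have cu: "continuous_on UNIV (u i)" "continuous_on UNIV (deriv (u i))" for i
      using admissible_smooth[OF u] by (auto intro: smooth_continuous_on smooth_deriv)
    have nz: "\<And>s'. s' \<in> U \<Longrightarrow> s' \<noteq> 0" using U by force
    have c1: "continuous_on (U \<times> cbox ?a ?b) (\<lambda>p. (snd p $ i - c $ i) / fst p)" for i
      by (intro continuous_intros) (use nz in auto)
    have "continuous_on (U \<times> cbox ?a ?b) (\<lambda>p. k' (fst p) i (snd p $ i))"
         "continuous_on (U \<times> cbox ?a ?b) (\<lambda>p. k (fst p) i (snd p $ i))" for i
      unfolding k'_def k_def
      by (intro continuous_on_divide continuous_on_minus continuous_on_add continuous_on_mult c1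
          continuous_on_compose2[OF cu(1) c1] continuous_on_compose2[OF cu(2) c1] continuous_on_power continuous_on_fst continuous_on_id; use nz in auto)+
    then show "continuous_on (U \<times> cbox ?a ?b) (\<lambda>(s', w). fx s' w)"
      unfolding fx_def case_prod_beta
      by (intro continuous_on_mult continuous_on_sum continuous_on_prod continuous_on_compose2[OF g]
          continuous_on_snd continuous_on_id) auto
  qed (use sU in \<open>auto simp: U_def\<close>)
  then have "((\<lambda>s'. integral (cbox ?a ?b) (\<lambda>w. g w * tensor (k s') w)) has_real_derivative
      integral (cbox ?a ?b) (fx s)) (at s)"
    using at_within_open[OF sU] by (simp add: U_def)
  then have D: "((\<lambda>s. \<integral>z. g (c + s *\<^sub>R z) * tensor u z \<partial>lborel) has_real_derivative
      integral (cbox ?a ?b) (fx s)) (at s)"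
    by (rule has_field_derivative_transform_within_open[of _ _ _ U]) (use sU subst in \<open>auto simp: U_def\<close>)
  have fx_eq: "fx s w = (\<Sum>i\<in>UNIV. - (g w * tensor ((k s)(i := deriv (q s i))) w))" for w
    by (simp add: fx_def tensor_fun_upd deriv_q sum_distrib_left)
  have adm_dq: "admissible ((k s)(i := deriv (q s i)))" for i
    using admissible_deriv[OF adm_q, of i i] by simp
  have "integral (cbox ?a ?b) (fx s) = (\<integral>w. fx s w \<partial>lborel)"
  proof (rule continuous_support_integral(2)[symmetric])
    show "continuous_on UNIV (fx s)"
      unfolding fx_eq by (intro continuous_intros g continuous_on_tensor adm_dq)
    show "fx s x = 0" if "x \<notin> cbox ?a ?b" for x
    proof -
      have "tensor ((k s)(i := deriv (q s i))) x = 0" for i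
        by (rule tensor_notin_cbox[OF _ that]) (use k_0[OF _ sU] k'_0[OF _ sU] deriv_q in auto)
      then show ?thesis by (simp add: fx_eq)
    qed
  qed
  also have "\<dots> = (\<Sum>i\<in>UNIV. - (\<integral>w. g w * tensor ((k s)(i := deriv (q s i))) w \<partial>lborel))"
    unfolding fx_eq using integrable_continuous_tensor[OF g adm_dq]
    by (subst Bochner_Integration.integral_sum) auto
  also have "\<dots> = (\<Sum>i\<in>UNIV. \<integral>w. h i w * tensor ((k s)(i := q s i)) w \<partial>lborel)"
  proof (rule sum.cong[OF refl])
    fix i
    show "- (\<integral>w. g w * tensor ((k s)(i := deriv (q s i))) w \<partial>lborel)
        = (\<integral>w. h i w * tensor ((k s)(i := q s i)) w \<partial>lborel)"
      using weak[OF adm_q[of i], of i] by simp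
  qed
  also have "\<dots> = (\<Sum>i\<in>UNIV. \<integral>z. h i (c + s *\<^sub>R z) * (z $ i * tensor u z) \<partial>lborel)"
  proof (rule sum.cong[OF refl])
    fix i
    have "tensor ((k s)(i := q s i)) w = (w $ i - c $ i) / s * tensor (k s) w" for w
      by (simp add: tensor_fun_upd tensor_split[of _ _ i] k_def q_def)
    moreover have "tensor (k s) (c + s *\<^sub>R z) = tensor u z / s ^ CARD('n)" for z
      using s by (simp add: tensor_def k_def prod_dividef)
    ultimately have *: "tensor ((k s)(i := q s i)) (c + s *\<^sub>R z) = z $ i * tensor u z / s ^ CARD('n)" for z
      using s by simp
    show "(\<integral>w. h i w * tensor ((k s)(i := q s i)) w \<partial>lborel) = (\<integral>z. h i (c + s *\<^sub>R z) * (z $ i * tensor u z) \<partial>lborel)"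
      using s borel_measurable_continuous_onI[OF continuous_on_tensor[OF adm_q[of i]]]
      by (subst lborel_integral_affine[of _ s c]) (auto simp: *)
  qed
  finally show ?thesis using D by simp
qed

section \<open>Taylor remainders\<close>

lemma taylor_remainder_powr:
  fixes f :: "nat \<Rightarrow> real \<Rightarrow> real"
  assumes \<theta>: "0 \<le> \<theta>" "\<theta> < 1" and A: "A \<ge> 0"
    and deriv: "\<And>k s. k \<le> m \<Longrightarrow> 0 < s \<Longrightarrow> (f k has_real_derivative f (Suc k) s) (at s)"
    and cont: "\<And>k. k \<le> m \<Longrightarrow> continuous_on UNIV (f k)"
    and bound: "\<And>s. 0 < s \<Longrightarrow> s \<le> \<rho> \<Longrightarrow> \<bar>f (Suc m) s\<bar> \<le> A * s powr (- \<theta>)"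
    and s: "0 < s" "s \<le> \<rho>"
  shows "\<bar>f 0 s - (\<Sum>k\<le>m. s ^ k / fact k * f k 0)\<bar> \<le> A / (1 - \<theta>) * s powr (real m + 1 - \<theta>)"
  using deriv cont bound s
proof (induction m arbitrary: f s)
  case 0
  have cont_powr: "continuous_on {0..s} (\<lambda>t. A / (1 - \<theta>) * t powr (1 - \<theta>))"
    using \<theta> by (intro continuous_intros continuous_on_powr') auto
  have "norm (f 0 s - f 0 0) \<le> A / (1 - \<theta>) * s powr (1 - \<theta>) - A / (1 - \<theta>) * 0 powr (1 - \<theta>)"
  proof (rule differentiable_bound_general[OF \<open>0 < s\<close> _ cont_powr])
    show "continuous_on {0..s} (f 0)"
      using 0(2)[of 0] by (auto intro: continuous_on_subset)
    fix t assume t: "0 < t" "t < s"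
    show "(f 0 has_vector_derivative f (Suc 0) t) (at t)"
      using 0(1)[of 0 t] t by (simp add: has_real_derivative_iff_has_vector_derivative)
    have "((\<lambda>t. A / (1 - \<theta>) * t powr (1 - \<theta>)) has_real_derivative
        A / (1 - \<theta>) * ((1 - \<theta>) * t powr (1 - \<theta> - 1))) (at t)"
      using t by (intro DERIV_cmult has_real_derivative_powr)
    then show "((\<lambda>t. A / (1 - \<theta>) * t powr (1 - \<theta>)) has_vector_derivative A * t powr (- \<theta>)) (at t)"
      using \<theta> by (simp add: has_real_derivative_iff_has_vector_derivative)
    show "norm (f (Suc 0) t) \<le> A * t powr (- \<theta>)"
      using 0(3)[of t] 0(5) t by simp
  qed
  then show ?case using \<theta> by simp
next
  case (Suc m)
  define B where "B = A / (1 - \<theta>)"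
  have B: "B \<ge> 0" using A \<theta> by (simp add: B_def)
  have IH: "\<bar>f (Suc 0) t - (\<Sum>k\<le>m. t ^ k / fact k * f (Suc k) 0)\<bar> \<le> B * t powr (real m + 1 - \<theta>)"
    if "0 < t" "t \<le> \<rho>" for t
    unfolding B_def using Suc.IH[of "\<lambda>k. f (Suc k)" t] Suc.prems that by auto
  define R where "R = (\<lambda>t. f 0 t - (\<Sum>k\<le>Suc m. t ^ k / fact k * f k 0))"
  have cont_powr: "continuous_on {0..s} (\<lambda>t. B * t powr (real m + 2 - \<theta>))"
    using \<theta> by (intro continuous_intros continuous_on_powr') auto
  have "norm (R s - R 0) \<le> B * s powr (real m + 2 - \<theta>) - B * 0 powr (real m + 2 - \<theta>)"
  proof (rule differentiable_bound_general[OF \<open>0 < s\<close> _ cont_powr])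
    show "continuous_on {0..s} R"
      unfolding R_def using Suc.prems(2)[of 0]
      by (intro continuous_intros) (auto intro: continuous_on_subset)
    fix t assume t: "0 < t" "t < s"
    have pow: "((\<lambda>t. t ^ Suc k / fact (Suc k) * f (Suc k) 0) has_real_derivative t ^ k / fact k * f (Suc k) 0) (at t)" for k
    proof -
      have "((\<lambda>t. t ^ Suc k / fact (Suc k) * f (Suc k) 0) has_real_derivative
          real (Suc k) * t ^ (Suc k - 1) / fact (Suc k) * f (Suc k) 0) (at t)"
        using DERIV_pow[of "Suc k" t] by (intro DERIV_cmult_right DERIV_cdivide) simp
      moreover have "real (Suc k) * t ^ (Suc k - 1) / fact (Suc k) = t ^ k / fact k"
        by (simp add: divide_simps)
      ultimately show ?thesis by simp
    qed
    have "(R has_real_derivative f (Suc 0) t - (0 + (\<Sum>k\<le>m. t ^ k / fact k * f (Suc k) 0))) (at t)"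
      unfolding R_def sum.atMost_Suc_shift
      by (intro DERIV_diff DERIV_add DERIV_sum pow Suc.prems(1)) (use t in auto)
    then show "(R has_vector_derivative f (Suc 0) t - (\<Sum>k\<le>m. t ^ k / fact k * f (Suc k) 0)) (at t)"
      by (simp add: has_real_derivative_iff_has_vector_derivative)
    have "((\<lambda>t. B * t powr (real m + 2 - \<theta>)) has_real_derivative
        B * ((real m + 2 - \<theta>) * t powr (real m + 2 - \<theta> - 1))) (at t)"
      using t by (intro DERIV_cmult has_real_derivative_powr)
    then show "((\<lambda>t. B * t powr (real m + 2 - \<theta>)) has_vector_derivative
        B * ((real m + 2 - \<theta>) * t powr (real m + 1 - \<theta>))) (at t)"
      by (simp add: has_real_derivative_iff_has_vector_derivative algebra_simps)
    have "1 * t powr (real m + 1 - \<theta>) \<le> (real m + 2 - \<theta>) * t powr (real m + 1 - \<theta>)"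
      using \<theta> by (intro mult_right_mono) auto
    then have "B * t powr (real m + 1 - \<theta>) \<le> B * ((real m + 2 - \<theta>) * t powr (real m + 1 - \<theta>))"
      using B by (intro mult_left_mono) auto
    then show "norm (f (Suc 0) t - (\<Sum>k\<le>m. t ^ k / fact k * f (Suc k) 0))
        \<le> B * ((real m + 2 - \<theta>) * t powr (real m + 1 - \<theta>))"
      using IH[of t] t Suc.prems(5) by simp
  qed
  moreover have "R 0 = 0"
    by (simp only: R_def sum.atMost_Suc_shift) simp
  ultimately show ?case
    by (simp add: R_def B_def algebra_simps)
qed

lemma finite_mi: "finite {j::'n::finite \<Rightarrow> nat. mi_abs j \<le> k}"
proof (rule finite_subset)
  show "{j::'n \<Rightarrow> nat. mi_abs j \<le> k} \<subseteq> PiE UNIV (\<lambda>_. {..k})"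
  proof
    fix j :: "'n \<Rightarrow> nat" assume j: "j \<in> {j. mi_abs j \<le> k}"
    have "j i \<le> mi_abs j" for i
      unfolding mi_abs_def by (rule member_le_sum) auto
    with j have "j i \<le> k" for i
      using order_trans by auto
    then show "j \<in> PiE UNIV (\<lambda>_. {..k})" by auto
  qed
  show "finite (PiE (UNIV::'n set) (\<lambda>_. {..k}))"
    by (intro finite_PiE) auto
qed

lemma finite_mi_eq: "finite {j::'n::finite \<Rightarrow> nat. mi_abs j = k}"
  by (rule finite_subset[OF _ finite_mi[of k]]) auto

lemma mi_fact_mi_Suc: "mi_fact (mi_Suc j i) = real (Suc (j i)) * mi_fact j"
proof -
  have "mi_fact j = fact (j i) * (\<Prod>l\<in>UNIV - {i}. fact (j l))" for j :: "'a \<Rightarrow> nat"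
    unfolding mi_fact_def by (rule prod.remove) auto
  then show ?thesis by simp
qed

lemma mi_fact_ge_1: "mi_fact j \<ge> 1"
  unfolding mi_fact_def by (intro prod_ge_1) auto

lemma mi_fact_neq_0 [simp]: "mi_fact j \<noteq> 0"
  using mi_fact_ge_1[of j] by linarith

lemma sum_mi_Suc:
  fixes A :: "('n::finite \<Rightarrow> nat) \<Rightarrow> real"
  shows "(\<Sum>j\<in>{j. mi_abs j = k}. (\<Sum>i\<in>UNIV. A (mi_Suc j i)) / mi_fact j)
    = real (Suc k) * (\<Sum>l\<in>{l. mi_abs l = Suc k}. A l / mi_fact l)"
proof -
  let ?S = "{j::'n \<Rightarrow> nat. mi_abs j = k}" and ?T = "{l::'n \<Rightarrow> nat. mi_abs l = Suc k}"
  have "(\<Sum>j\<in>?S. (\<Sum>i\<in>UNIV. A (mi_Suc j i)) / mi_fact j)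
      = (\<Sum>(j, i)\<in>?S \<times> UNIV. A (mi_Suc j i) / mi_fact j)"
    by (simp add: sum.cartesian_product sum_divide_distrib)
  also have "\<dots> = (\<Sum>(l, i)\<in>{(l, i). l \<in> ?T \<and> l i > 0}. A l * real (l i) / mi_fact l)"
  proof (rule sum.reindex_bij_witness[where j = "\<lambda>(j, i). (mi_Suc j i, i)" and i = "\<lambda>(l, i). (l(i := l i - 1), i)"])
    fix a assume "a \<in> {(l, i). l \<in> ?T \<and> l i > 0}"
    then obtain l i where a: "a = (l, i)" "mi_abs l = Suc k" "l i > 0" by auto
    have "mi_Suc (l(i := l i - 1)) i = l"
      using a(3) by auto
    then show "(case case a of (l, i) \<Rightarrow> (l(i := l i - 1), i) of (j, i) \<Rightarrow> (mi_Suc j i, i)) = a"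
      "(case a of (l, i) \<Rightarrow> (l(i := l i - 1), i)) \<in> ?S \<times> UNIV"
      using a mi_abs_mi_Suc[of "l(i := l i - 1)" i] by auto
  next
    fix a assume "a \<in> ?S \<times> (UNIV :: 'n set)"
    then obtain j i where a: "a = (j, i)" "mi_abs j = k" by auto
    show "(case case a of (j, i) \<Rightarrow> (mi_Suc j i, i) of (l, i) \<Rightarrow> (l(i := l i - 1), i)) = a"
      "(case a of (j, i) \<Rightarrow> (mi_Suc j i, i)) \<in> {(l, i). l \<in> ?T \<and> l i > 0}"
      using a by (auto simp: mi_abs_mi_Suc)
    show "(case case a of (j, i) \<Rightarrow> (mi_Suc j i, i) of (l, i) \<Rightarrow> A l * real (l i) / mi_fact l)
        = (case a of (j, i) \<Rightarrow> A (mi_Suc j i) / mi_fact j)"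
      using mi_fact_ge_1[of j] by (simp add: a mi_fact_mi_Suc del: of_nat_Suc)
  qed
  also have "\<dots> = (\<Sum>(l, i)\<in>?T \<times> UNIV. A l * real (l i) / mi_fact l)"
    by (rule sum.mono_neutral_left) (auto intro: finite_cartesian_product finite_mi_eq)
  also have "\<dots> = (\<Sum>l\<in>?T. \<Sum>i\<in>UNIV. A l * real (l i) / mi_fact l)"
    by (simp add: sum.cartesian_product)
  also have "\<dots> = (\<Sum>l\<in>?T. A l / mi_fact l * real (mi_abs l))"
  proof (rule sum.cong[OF refl])
    fix l :: "'n \<Rightarrow> nat"
    have "(\<Sum>i\<in>UNIV. A l * real (l i) / mi_fact l) = (\<Sum>i\<in>UNIV. A l / mi_fact l * real (l i))"
      by simp
    also have "\<dots> = A l / mi_fact l * real (mi_abs l)"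
      unfolding mi_abs_def of_nat_sum by (rule sum_distrib_left[symmetric])
    finally show "(\<Sum>i\<in>UNIV. A l * real (l i) / mi_fact l) = A l / mi_fact l * real (mi_abs l)" .
  qed
  also have "\<dots> = real (Suc k) * (\<Sum>l\<in>?T. A l / mi_fact l)"
    by (simp add: sum_distrib_left mult.commute)
  finally show ?thesis .
qed

lemma alternating_sum_poly_eq_0:
  fixes p :: "real poly"
  assumes "p = 0 \<or> degree p < m"
  shows "(\<Sum>k\<le>m. (-1) ^ k * real (m choose k) * poly p (real k)) = 0"
  using assms
proof (induction m arbitrary: p)
  case (Suc m)
  define d where "d = pcompose p [:1, 1:] - p"
  have "d = 0 \<or> degree d < m"
  proof (rule disjCI)
    assume "\<not> degree d < m"
    have deg: "degree (pcompose p [:1, 1:]) = degree p"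
      by (simp add: degree_pcompose)
    then have "degree d \<le> degree p"
      unfolding d_def by (intro degree_diff_le) auto
    then have "degree d = degree p"
      using \<open>\<not> degree d < m\<close> Suc.prems by (cases "p = 0") auto
    moreover have "coeff d (degree p) = 0"
      using lead_coeff_comp[of "[:1, 1:]" p] deg by (simp add: d_def)
    ultimately show "d = 0"
      using leading_coeff_0_iff[of d] by simp
  qed
  then have IH: "(\<Sum>k\<le>m. (-1) ^ k * real (m choose k) * poly d (real k)) = 0"
    by (rule Suc.IH)
  have "(\<Sum>k\<le>Suc m. (-1) ^ k * real (Suc m choose k) * poly p (real k)) =
      poly p 0 + (\<Sum>k\<le>m. (-1) ^ Suc k * real (Suc m choose Suc k) * poly p (real (Suc k)))"
    by (simp only: sum.atMost_Suc_shift) simp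
  also have "\<dots> = - (\<Sum>k\<le>m. (-1) ^ k * real (m choose k) * poly p (real (Suc k)))
      + (poly p 0 + (\<Sum>k\<le>m. (-1) ^ Suc k * real (m choose Suc k) * poly p (real (Suc k))))"
    by (simp add: sum.distrib algebra_simps sum_negf sum_subtractf del: of_nat_Suc)
  also have "poly p 0 + (\<Sum>k\<le>m. (-1) ^ Suc k * real (m choose Suc k) * poly p (real (Suc k)))
      = (\<Sum>k\<le>Suc m. (-1) ^ k * real (m choose k) * poly p (real k))"
    by (simp only: sum.atMost_Suc_shift) simp
  also have "\<dots> = (\<Sum>k\<le>m. (-1) ^ k * real (m choose k) * poly p (real k))"
    by simp
  finally show ?case
    using IH by (simp add: d_def poly_pcompose algebra_simps sum_subtractf)
qed auto

lemma taylor_jet_line_eq_poly: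
  assumes "m \<ge> 1"
  shows "\<exists>P. degree P < m \<and> (\<forall>t. taylor_jet m G y (x + t *\<^sub>R z) = poly P t)"
proof -
  define P where "P = (\<Sum>j\<in>{j. mi_abs j \<le> m - 1}.
      smult (G j y / mi_fact j) (\<Prod>i\<in>UNIV. [:x $ i - y $ i, z $ i:] ^ j i))"
  have "degree (smult (G j y / mi_fact j) (\<Prod>i\<in>UNIV. [:x $ i - y $ i, z $ i:] ^ j i)) \<le> m - 1"
    if "mi_abs j \<le> m - 1" for j
  proof -
    have "degree (\<Prod>i\<in>UNIV. [:x $ i - y $ i, z $ i:] ^ j i) \<le> (\<Sum>i\<in>UNIV. degree ([:x $ i - y $ i, z $ i:] ^ j i))"
      using degree_prod_sum_le[of UNIV "\<lambda>i. [:x $ i - y $ i, z $ i:] ^ j i"] by (simp add: o_def)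
    also have "\<dots> \<le> (\<Sum>i\<in>UNIV. j i)"
    proof (rule sum_mono)
      fix i
      have "degree ([:x $ i - y $ i, z $ i:] ^ j i) \<le> degree [:x $ i - y $ i, z $ i:] * j i"
        by (rule degree_power_le)
      also have "\<dots> \<le> 1 * j i"
        by (intro mult_right_mono) auto
      finally show "degree ([:x $ i - y $ i, z $ i:] ^ j i) \<le> j i" by simp
    qed
    finally show ?thesis
      using that by (intro order_trans[OF degree_smult_le]) (simp add: mi_abs_def)
  qed
  then have "degree P \<le> m - 1"
    unfolding P_def by (intro degree_sum_le finite_mi) auto
  then have "degree P < m"
    using assms by simp
  moreover have "taylor_jet m G y (x + t *\<^sub>R z) = poly P t" for t
  proof -
    have "(x + t *\<^sub>R z - y) $ i = poly [:x $ i - y $ i, z $ i:] t" for i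
      by simp
    then show ?thesis
      unfolding taylor_jet_def P_def mi_pow_def by (simp only: poly_sum poly_prod poly_smult poly_power)
  qed
  ultimately show ?thesis
    by (intro exI[of _ P] conjI allI)
qed

section \<open>The pointwise estimate\<close>

lemma scale_average_bound:
  fixes g h \<psi> :: "real^'n::finite \<Rightarrow> real"
  assumes [measurable]: "g \<in> borel_measurable borel" "h \<in> borel_measurable borel"
    and gh: "\<And>w. \<bar>g w\<bar> \<le> h w" and \<psi>: "\<And>z. \<bar>\<psi> z\<bar> \<le> M" "\<And>z. R \<le> norm z \<Longrightarrow> \<psi> z = 0"
    and pos: "R > 0" "q > 1" "N > 0" "0 < s" "s \<le> \<rho>" "norm (x - c) \<le> \<rho>"
    and ball: "\<And>t. t > 0 \<Longrightarrow> (\<integral>\<^sup>+ w. ennreal (h w powr q) * indicator (ball x t) w \<partial>lborel)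
      \<le> ennreal (t ^ CARD('n) * N powr q)"
  shows "\<bar>\<integral>z. g (c + s *\<^sub>R z) * \<psi> z \<partial>lborel\<bar>
    \<le> M * (unit_ball_vol (real CARD('n)) * R ^ CARD('n) + (R + 1) ^ CARD('n)) * N * (\<rho> / s) powr (CARD('n) / q)"
proof -
  define V where "V = unit_ball_vol (real CARD('n))"
  have V: "V > 0" by (simp add: V_def)
  define n where "n = CARD('n)"
  \<comment> \<open>Splitting \<open>h\<close> at the level \<open>\<tau>\<close> replaces Hoelder's inequality; \<open>\<tau>\<close> balances the two parts.\<close>
  define \<tau> where "\<tau> = N * (\<rho> / s) powr (n / q)"
  have \<rho>: "\<rho> > 0" using pos by simp
  have \<tau>: "\<tau> > 0" using pos \<rho> by (simp add: \<tau>_def)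
  have M: "M \<ge> 0" using \<psi>(1)[of 0] by simp
  have h0: "h w \<ge> 0" for w using gh[of w] by simp
  have \<tau>_q: "\<tau> powr (1 - q) * (\<rho> ^ n * N powr q) = \<tau> * s ^ n"
  proof -
    have "\<tau> powr q = N powr q * (\<rho> / s) ^ n"
      using pos \<rho> by (simp add: \<tau>_def powr_mult powr_powr powr_realpow)
    then have "\<tau> powr (1 - q) = \<tau> / (N powr q * (\<rho> / s) ^ n)"
      using \<tau> by (simp add: powr_diff)
    then show ?thesis
      using pos \<rho> by (simp add: power_divide)
  qed
  have young: "h w \<le> \<tau> + \<tau> powr (1 - q) * h w powr q" for w
  proof (cases "h w \<le> \<tau>")
    case True
    then show ?thesis by (simp add: add_increasing2)
  next
    case False
    then have "h w powr (1 - q) \<le> \<tau> powr (1 - q)"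
      using pos \<tau> by (intro powr_mono2') auto
    then have "h w powr (1 - q) * h w powr q \<le> \<tau> powr (1 - q) * h w powr q"
      by (intro mult_right_mono) auto
    then show ?thesis
      using False \<tau> by (simp add: powr_add[symmetric])
  qed
  define H where "H = (\<lambda>w. (ennreal \<tau> + ennreal (\<tau> powr (1 - q)) * ennreal (h w powr q)) * indicator (ball c (s * R)) w)"
  have [measurable]: "ball y t \<in> sets borel" for y :: "real^'n" and t by simp
  have [measurable]: "H \<in> borel_measurable borel" unfolding H_def by measurable
  define B where "B = \<tau> * (V * R ^ n + (R + 1) ^ n)"
  have B: "B \<ge> 0" using \<tau> V pos by (simp add: B_def)
  have "(\<integral>\<^sup>+ w. H w \<partial>lborel) = (\<integral>\<^sup>+ w. ennreal \<tau> * indicator (ball c (s * R)) w \<partial>lborel) +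
      (\<integral>\<^sup>+ w. ennreal (\<tau> powr (1 - q)) * (ennreal (h w powr q) * indicator (ball c (s * R)) w) \<partial>lborel)"
    unfolding H_def by (subst nn_integral_add[symmetric]) (measurable, simp add: distrib_right mult.assoc)
  also have "\<dots> = ennreal (\<tau> * (V * (s * R) ^ n)) +
      ennreal (\<tau> powr (1 - q)) * (\<integral>\<^sup>+ w. ennreal (h w powr q) * indicator (ball c (s * R)) w \<partial>lborel)"
    using pos \<tau> V
    by (subst nn_integral_cmult) (measurable, simp add: nn_integral_cmult_indicator emeasure_ball V_def n_def ennreal_mult)
  also have "\<dots> \<le> ennreal (\<tau> * (V * (s * R) ^ n)) +
      ennreal (\<tau> powr (1 - q)) * ennreal ((\<rho> * (R + 1)) ^ n * N powr q)"
  proof (intro add_left_mono mult_left_mono)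
    have "ball c (s * R) \<subseteq> ball x (\<rho> * (R + 1))"
    proof
      fix w assume "w \<in> ball c (s * R)"
      then have "dist c w < s * R" by simp
      moreover have "s * R \<le> \<rho> * R" using pos by simp
      moreover have "dist x w \<le> dist x c + dist c w" by (rule dist_triangle)
      moreover have "dist x c \<le> \<rho>" using pos by (simp add: dist_norm)
      ultimately show "w \<in> ball x (\<rho> * (R + 1))" by (simp add: distrib_left)
    qed
    then have "(\<integral>\<^sup>+ w. ennreal (h w powr q) * indicator (ball c (s * R)) w \<partial>lborel)
        \<le> (\<integral>\<^sup>+ w. ennreal (h w powr q) * indicator (ball x (\<rho> * (R + 1))) w \<partial>lborel)"
      by (intro nn_integral_mono mult_left_mono) (auto split: split_indicator)
    also have "\<dots> \<le> ennreal ((\<rho> * (R + 1)) ^ n * N powr q)"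
      unfolding n_def using pos \<rho> by (intro ball) simp
    finally show "(\<integral>\<^sup>+ w. ennreal (h w powr q) * indicator (ball c (s * R)) w \<partial>lborel)
        \<le> ennreal ((\<rho> * (R + 1)) ^ n * N powr q)" .
  qed auto
  also have "\<dots> = ennreal (\<tau> * (V * (s * R) ^ n) + \<tau> powr (1 - q) * ((\<rho> * (R + 1)) ^ n * N powr q))"
    using \<tau> V pos \<rho> by (simp add: ennreal_mult[symmetric] ennreal_plus[symmetric] del: ennreal_plus)
  also have "\<tau> powr (1 - q) * ((\<rho> * (R + 1)) ^ n * N powr q) = \<tau> * s ^ n * (R + 1) ^ n"
    using \<tau>_q by (simp add: power_mult_distrib mult_ac)
  also have "\<tau> * (V * (s * R) ^ n) + \<tau> * s ^ n * (R + 1) ^ n = s ^ n * B"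
    by (simp add: B_def power_mult_distrib algebra_simps)
  finally have "ennreal (s ^ n) * (\<integral>\<^sup>+ z. H (c + s *\<^sub>R z) \<partial>lborel) \<le> ennreal (s ^ n) * ennreal B"
    using lborel_nn_integral_affine[of H s c] pos B by (simp add: n_def ennreal_mult)
  then have H_le: "(\<integral>\<^sup>+ z. H (c + s *\<^sub>R z) \<partial>lborel) \<le> ennreal B"
    using pos by (subst (asm) ennreal_mult_le_mult_iff) auto
  have "ennreal \<bar>\<integral>z. g (c + s *\<^sub>R z) * \<psi> z \<partial>lborel\<bar> \<le> (\<integral>\<^sup>+ z. ennreal \<bar>g (c + s *\<^sub>R z) * \<psi> z\<bar> \<partial>lborel)"
    using integral_norm_bound_ennreal[of lborel "\<lambda>z. g (c + s *\<^sub>R z) * \<psi> z"]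
      not_integrable_integral_eq[of lborel "\<lambda>z. g (c + s *\<^sub>R z) * \<psi> z"]
    by (cases "integrable lborel (\<lambda>z. g (c + s *\<^sub>R z) * \<psi> z)") auto
  also have "\<dots> \<le> (\<integral>\<^sup>+ z. ennreal M * H (c + s *\<^sub>R z) \<partial>lborel)"
  proof (rule nn_integral_mono)
    fix z
    show "ennreal \<bar>g (c + s *\<^sub>R z) * \<psi> z\<bar> \<le> ennreal M * H (c + s *\<^sub>R z)"
    proof (cases "R \<le> norm z")
      case False
      let ?w = "c + s *\<^sub>R z"
      have "?w \<in> ball c (s * R)"
        using False pos by (simp add: dist_norm)
      moreover have "\<bar>g ?w * \<psi> z\<bar> \<le> (\<tau> + \<tau> powr (1 - q) * h ?w powr q) * M"
        unfolding abs_mult using order_trans[OF gh young[of ?w]] \<psi>(1)[of z] \<tau>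
        by (intro mult_mono) (auto intro: add_nonneg_nonneg)
      ultimately show ?thesis
        using \<tau> M by (simp add: H_def ennreal_mult[symmetric] ennreal_plus[symmetric] mult.commute del: ennreal_plus)
    qed (simp add: \<psi>(2))
  qed
  also have "\<dots> = ennreal M * (\<integral>\<^sup>+ z. H (c + s *\<^sub>R z) \<partial>lborel)"
    by (intro nn_integral_cmult) measurable
  also have "\<dots> \<le> ennreal M * ennreal B"
    by (intro mult_left_mono H_le) auto
  also have "\<dots> = ennreal (M * B)"
    using M B by (simp add: ennreal_mult)
  finally have "\<bar>\<integral>z. g (c + s *\<^sub>R z) * \<psi> z \<partial>lborel\<bar> \<le> M * B"
    using M B by simp
  then show ?thesis
    by (simp add: B_def \<tau>_def V_def n_def mult_ac)
qed

definition jet_of :: "nat \<Rightarrow> (real^'n::finite \<Rightarrow> real) \<Rightarrow> (('n \<Rightarrow> nat) \<Rightarrow> real^'n \<Rightarrow> real) \<Rightarrow> bool" where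
  "jet_of m F G \<longleftrightarrow> (\<forall>j. mi_abs j \<le> m \<longrightarrow> G j \<in> borel_measurable borel \<and> weak_deriv j F (G j)) \<and>
    (\<forall>j. mi_abs j < m \<longrightarrow> continuous_on UNIV (G j))"

definition mi_weight :: "('n \<Rightarrow> nat) \<Rightarrow> ('n \<Rightarrow> real \<Rightarrow> real) \<Rightarrow> 'n \<Rightarrow> real \<Rightarrow> real" where
  "mi_weight j u i t = t ^ j i * u i t"

lemma tensor_mi_weight: "tensor (mi_weight j u) z = mi_pow z j * tensor u z"
  by (simp add: tensor_def mi_pow_def mi_weight_def prod.distrib)

lemma mi_pow_mi_Suc: "mi_pow z (mi_Suc j i) = z $ i * mi_pow z j"
proof -
  have "mi_pow z j = z $ i ^ j i * (\<Prod>l\<in>UNIV - {i}. z $ l ^ j l)" for j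
    unfolding mi_pow_def by (rule prod.remove) auto
  then show ?thesis by simp
qed

lemma mi_pow_scaleR: "mi_pow (a *\<^sub>R z) j = a ^ mi_abs j * mi_pow z j"
  by (simp add: mi_pow_def mi_abs_def power_mult_distrib prod.distrib power_sum)

lemma mi_abs_zero_eq: "{j::'n::finite \<Rightarrow> nat. mi_abs j = 0} = {\<lambda>_. 0}"
  by (auto simp: mi_abs_def fun_eq_iff)

lemma admissible_mi_weight:
  assumes "admissible u" shows "admissible (mi_weight j u)"
proof -
  obtain R where R: "\<And>i t. \<bar>t\<bar> > R \<Longrightarrow> u i t = 0"
    using assms by (rule admissible_bound) blast
  have "smooth (\<lambda>t. t ^ j i * u i t)" for i
    by (rule smooth_mult[OF smooth_power admissible_smooth[OF assms]])
  then show ?thesis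
    unfolding admissible_def mi_weight_def using R by (intro allI conjI exI[of _ R]) auto
qed

lemma tensor_mi_weight_bound:
  assumes "\<And>i t. \<bar>t\<bar> > 2 \<Longrightarrow> u i t = 0" "\<And>i t. \<bar>u i t\<bar> \<le> 1"
  shows "\<bar>tensor (mi_weight j u) z\<bar> \<le> 2 ^ mi_abs j"
proof -
  have "\<bar>mi_weight j u i t\<bar> \<le> 2 ^ j i" for i t
  proof (cases "\<bar>t\<bar> > 2")
    case False
    then have "\<bar>t\<bar> ^ j i * \<bar>u i t\<bar> \<le> 2 ^ j i * 1"
      using assms(2) by (intro mult_mono power_mono) auto
    then show ?thesis by (simp add: mi_weight_def abs_mult power_abs)
  qed (simp add: mi_weight_def assms(1))
  then have "(\<Prod>i\<in>UNIV. \<bar>mi_weight j u i (z $ i)\<bar>) \<le> (\<Prod>i\<in>UNIV. 2 ^ j i)"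
    by (intro prod_mono) auto
  then show ?thesis
    by (simp add: tensor_def abs_prod mi_abs_def power_sum)
qed

lemma tensor_mi_weight_support:
  fixes z :: "real^'n::finite"
  assumes "\<And>i t. \<bar>t\<bar> > 2 \<Longrightarrow> u i t = 0" "2 * real CARD('n) + 1 \<le> norm z"
  shows "tensor (mi_weight j u) z = 0"
proof -
  obtain i where "\<bar>z $ i\<bar> > 2"
  proof (rule ccontr)
    assume "\<not> thesis"
    with that have "\<And>i. \<bar>z $ i\<bar> \<le> 2" by (auto simp: not_less[symmetric])
    then have "(\<Sum>i\<in>UNIV. \<bar>z $ i\<bar>) \<le> (\<Sum>i\<in>(UNIV::'n set). 2)"
      by (intro sum_mono)
    with norm_le_l1_cart[of z] assms(2) show False by simp
  qed
  then show ?thesis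
    by (intro tensor_eq_0[of 2 _ z i]) (auto simp: mi_weight_def assms(1))
qed

lemma abs_le_grad_norm:
  fixes G :: "('n::finite \<Rightarrow> nat) \<Rightarrow> real^'n \<Rightarrow> real"
  assumes "mi_abs j = m"
  shows "\<bar>G j w\<bar> \<le> grad_norm m G w"
proof -
  have "sqrt ((G j w)\<^sup>2) \<le> grad_norm m G w"
    unfolding grad_norm_def using assms
    by (intro real_sqrt_le_mono member_le_sum) (auto simp: finite_mi_eq)
  then show ?thesis by simp
qed

lemma borel_measurable_grad_norm:
  assumes "\<And>j. mi_abs j \<le> m \<Longrightarrow> G j \<in> borel_measurable borel"
  shows "grad_norm m G \<in> borel_measurable borel"
proof -
  have [measurable]: "(\<lambda>x. \<Sum>\<alpha>\<in>{\<alpha>. mi_abs \<alpha> = m}. (G \<alpha> x)\<^sup>2) \<in> borel_measurable borel"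
    by (intro borel_measurable_sum borel_measurable_power assms) auto
  show ?thesis
    unfolding grad_norm_def by measurable
qed

lemma taylor_jet_average:
  fixes G :: "('n::finite \<Rightarrow> nat) \<Rightarrow> real^'n \<Rightarrow> real"
  assumes u: "admissible u" and m: "m \<ge> 1"
  shows "(\<integral>z. taylor_jet m G c (c + \<rho> *\<^sub>R z) * tensor u z \<partial>lborel) =
    (\<Sum>k\<le>m - 1. \<rho> ^ k * (\<Sum>j\<in>{j. mi_abs j = k}. G j c * (\<integral>z. tensor (mi_weight j u) z \<partial>lborel) / mi_fact j))"
proof -
  have int: "integrable lborel (tensor (mi_weight j u))" for j
    using integrable_continuous_tensor[of "\<lambda>_. 1", OF _ admissible_mi_weight[OF u, of j]] by simp
  have "(\<integral>z. taylor_jet m G c (c + \<rho> *\<^sub>R z) * tensor u z \<partial>lborel) =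
      (\<integral>z. (\<Sum>j\<in>{j. mi_abs j \<le> m - 1}. G j c / mi_fact j * \<rho> ^ mi_abs j * tensor (mi_weight j u) z) \<partial>lborel)"
    unfolding taylor_jet_def sum_distrib_right by (simp add: mi_pow_scaleR tensor_mi_weight mult_ac)
  also have "\<dots> = (\<Sum>j\<in>{j. mi_abs j \<le> m - 1}. G j c / mi_fact j * \<rho> ^ mi_abs j * (\<integral>z. tensor (mi_weight j u) z \<partial>lborel))"
    using int by (subst Bochner_Integration.integral_sum) auto
  also have "\<dots> = (\<Sum>k\<le>m - 1. \<Sum>j\<in>{j \<in> {j. mi_abs j \<le> m - 1}. mi_abs j = k}.
      G j c / mi_fact j * \<rho> ^ mi_abs j * (\<integral>z. tensor (mi_weight j u) z \<partial>lborel))"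
    by (rule sum.group[symmetric]) (auto simp: finite_mi)
  also have "\<dots> = (\<Sum>k\<le>m - 1. \<rho> ^ k * (\<Sum>j\<in>{j. mi_abs j = k}. G j c * (\<integral>z. tensor (mi_weight j u) z \<partial>lborel) / mi_fact j))"
    unfolding sum_distrib_left by (intro sum.cong) auto
  finally show ?thesis .
qed

text \<open>The \<open>k\<close>-th derivative in the scale \<open>s\<close> of the average of \<open>G 0 (c + s z)\<close> is the average of the
  \<open>k\<close>-homogeneous part of the jet; the \<open>m\<close>-th one blows up like \<open>s\<^sup>-\<^sup>n\<^sup>/\<^sup>q\<close>, which is integrable
  at \<open>0\<close> because \<open>q > n\<close>.\<close>

lemma taylor_average_bound:
  fixes q :: real
  assumes m: "m \<ge> 1" and q: "q > real CARD('n::finite)"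
  shows "\<exists>C>0. \<forall>(F :: real^'n \<Rightarrow> real) G u c x \<rho> N. jet_of m F G \<longrightarrow> admissible u \<longrightarrow>
    (\<forall>i t. \<bar>t\<bar> > 2 \<longrightarrow> u i t = 0) \<longrightarrow> (\<forall>i t. \<bar>u i t\<bar> \<le> 1) \<longrightarrow> N > 0 \<longrightarrow> \<rho> > 0 \<longrightarrow> norm (x - c) \<le> \<rho> \<longrightarrow>
    (\<forall>t>0. (\<integral>\<^sup>+ w. ennreal (grad_norm m G w powr q) * indicator (ball x t) w \<partial>lborel)
      \<le> ennreal (t ^ CARD('n) * N powr q)) \<longrightarrow>
    \<bar>(\<integral>z. G (\<lambda>_. 0) (c + \<rho> *\<^sub>R z) * tensor u z \<partial>lborel) -
      (\<integral>z. taylor_jet m G c (c + \<rho> *\<^sub>R z) * tensor u z \<partial>lborel)\<bar> \<le> C * N * \<rho> ^ m"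
proof -
  define n where "n = CARD('n)"
  have n: "n \<ge> 1" by (simp add: n_def Suc_le_eq)
  define R where "R = 2 * real n + 1"
  define K0 where "K0 = 2 ^ m * (unit_ball_vol (real n) * R ^ n + (R + 1) ^ n)"
  define K1 where "K1 = fact m * (real (card {j::'n \<Rightarrow> nat. mi_abs j = m}) * K0)"
  define \<theta> where "\<theta> = n / q"
  define C where "C = K1 / (1 - \<theta>) + 1"
  have \<theta>: "0 \<le> \<theta>" "\<theta> < 1" using q n by (auto simp: \<theta>_def n_def)
  have K0: "K0 \<ge> 0" by (simp add: K0_def R_def)
  have K1: "K1 \<ge> 0" using K0 by (simp add: K1_def)
  have "C > 0" using K1 \<theta> by (simp add: C_def add_nonneg_pos)
  moreover have "\<bar>(\<integral>z. G (\<lambda>_. 0) (c + \<rho> *\<^sub>R z) * tensor u z \<partial>lborel) -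
      (\<integral>z. taylor_jet m G c (c + \<rho> *\<^sub>R z) * tensor u z \<partial>lborel)\<bar> \<le> C * N * \<rho> ^ m"
    if jet: "jet_of m F G" and u: "admissible u" "\<And>i t. \<bar>t\<bar> > 2 \<Longrightarrow> u i t = 0" "\<And>i t. \<bar>u i t\<bar> \<le> 1"
    and pos: "N > 0" "\<rho> > 0" "norm (x - c) \<le> \<rho>"
    and ball: "\<And>t. t > 0 \<Longrightarrow> (\<integral>\<^sup>+ w. ennreal (grad_norm m G w powr q) * indicator (ball x t) w \<partial>lborel)
      \<le> ennreal (t ^ CARD('n) * N powr q)"
    for F :: "real^'n \<Rightarrow> real" and G u c x \<rho> N
  proof -
    have meas: "\<And>j. mi_abs j \<le> m \<Longrightarrow> G j \<in> borel_measurable borel"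
      and weak: "\<And>j. mi_abs j \<le> m \<Longrightarrow> weak_deriv j F (G j)"
      and cont: "\<And>j. mi_abs j < m \<Longrightarrow> continuous_on UNIV (G j)"
      using jet by (auto simp: jet_of_def)
    note adm = admissible_mi_weight[OF u(1)]
    define I where "I = (\<lambda>j s. \<integral>z. G j (c + s *\<^sub>R z) * tensor (mi_weight j u) z \<partial>lborel)"
    define f where "f = (\<lambda>k s. fact k * (\<Sum>j\<in>{j. mi_abs j = k}. I j s / mi_fact j))"
    have DERIV_I: "(I j has_real_derivative (\<Sum>i\<in>UNIV. I (mi_Suc j i) s)) (at s)"
      if j: "mi_abs j < m" and s: "s > 0" for j s
    proof -
      have "((\<lambda>s. \<integral>z. G j (c + s *\<^sub>R z) * tensor (mi_weight j u) z \<partial>lborel) has_real_derivative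
        (\<Sum>i\<in>UNIV. \<integral>z. G (mi_Suc j i) (c + s *\<^sub>R z) * (z $ i * tensor (mi_weight j u) z) \<partial>lborel)) (at s)"
      proof (rule scale_average_DERIV[OF cont[OF j] _ _ adm s])
        show "G (mi_Suc j i) \<in> borel_measurable borel" for i
          using j by (intro meas) (simp add: mi_abs_mi_Suc)
        show "(\<integral>x. G j x * tensor (v(i := deriv (v i))) x \<partial>lborel) = - (\<integral>x. G (mi_Suc j i) x * tensor v x \<partial>lborel)"
          if "admissible v" for i v
          using j that by (intro weak_deriv_step[of j F] weak) (auto simp: mi_abs_mi_Suc)
      qed
      then show ?thesis
        by (simp add: I_def tensor_mi_weight mi_pow_mi_Suc mult.assoc)
    qed
    have DERIV_f: "(f k has_real_derivative f (Suc k) s) (at s)" if "k \<le> m - 1" "0 < s" for k s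
    proof -
      have "(f k has_real_derivative fact k * (\<Sum>j\<in>{j. mi_abs j = k}. (\<Sum>i\<in>UNIV. I (mi_Suc j i) s) / mi_fact j)) (at s)"
        unfolding f_def using that m by (intro DERIV_cmult DERIV_sum DERIV_cdivide DERIV_I) auto
      then show ?thesis
        unfolding sum_mi_Suc[of "\<lambda>j. I j s"] by (simp add: f_def mult_ac)
    qed
    have cont_f: "continuous_on UNIV (f k)" if "k \<le> m - 1" for k
      unfolding f_def I_def using that m
      by (intro continuous_on_mult_left continuous_on_sum continuous_on_divide continuous_on_const
          scale_average_continuous[OF cont adm]) auto
    have I_le: "\<bar>I j s\<bar> \<le> K0 * N * (\<rho> / s) powr \<theta>" if "mi_abs j = m" "0 < s" "s \<le> \<rho>" for j s
    proof -
      have "\<bar>\<integral>z. G j (c + s *\<^sub>R z) * tensor (mi_weight j u) z \<partial>lborel\<bar>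
        \<le> 2 ^ m * (unit_ball_vol (real CARD('n)) * R ^ CARD('n) + (R + 1) ^ CARD('n)) * N * (\<rho> / s) powr (CARD('n) / q)"
      proof (rule scale_average_bound[where h = "grad_norm m G" and x = x])
        show "\<bar>tensor (mi_weight j u) z\<bar> \<le> 2 ^ m" for z
          using tensor_mi_weight_bound[of u j z] u(2,3) that by simp
        show "tensor (mi_weight j u) z = 0" if "R \<le> norm z" for z
          using that by (intro tensor_mi_weight_support u(2)) (simp_all add: R_def n_def)
        show "q > 1" by (rule le_less_trans[OF _ q]) simp
      qed (use that pos ball meas borel_measurable_grad_norm[of m G] abs_le_grad_norm[of j m G] in \<open>auto simp: R_def\<close>)
      then show ?thesis by (simp add: I_def K0_def n_def \<theta>_def)
    qed
    have bound_f: "\<bar>f (Suc (m - 1)) s\<bar> \<le> (K1 * N * \<rho> powr \<theta>) * s powr (- \<theta>)" if "0 < s" "s \<le> \<rho>" for s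
    proof -
      have "\<bar>\<Sum>j\<in>{j. mi_abs j = m}. I j s / mi_fact j\<bar> \<le> (\<Sum>j\<in>{j::'n \<Rightarrow> nat. mi_abs j = m}. K0 * N * (\<rho> / s) powr \<theta>)"
      proof (rule order_trans[OF sum_abs], rule sum_mono)
        fix j :: "'n \<Rightarrow> nat" assume "j \<in> {j. mi_abs j = m}"
        then have "\<bar>I j s\<bar> \<le> K0 * N * (\<rho> / s) powr \<theta>"
          using I_le that by simp
        moreover have "\<bar>I j s / mi_fact j\<bar> \<le> \<bar>I j s\<bar>"
          using mi_fact_ge_1[of j] mult_left_mono[of 1 "mi_fact j" "\<bar>I j s\<bar>"]
          by (simp add: abs_divide divide_le_eq)
        ultimately show "\<bar>I j s / mi_fact j\<bar> \<le> K0 * N * (\<rho> / s) powr \<theta>" by linarith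
      qed
      then have "\<bar>f m s\<bar> \<le> fact m * (real (card {j::'n \<Rightarrow> nat. mi_abs j = m}) * (K0 * N * (\<rho> / s) powr \<theta>))"
        unfolding f_def abs_mult by (intro mult_mono) auto
      also have "(\<rho> / s) powr \<theta> = \<rho> powr \<theta> * s powr (- \<theta>)"
        using that pos by (simp add: powr_divide powr_minus field_simps)
      finally show ?thesis
        using m by (simp add: K1_def mult_ac)
    qed
    have "\<bar>f 0 \<rho> - (\<Sum>k\<le>m - 1. \<rho> ^ k / fact k * f k 0)\<bar>
        \<le> K1 * N * \<rho> powr \<theta> / (1 - \<theta>) * \<rho> powr (real (m - 1) + 1 - \<theta>)"
      using \<theta> K1 pos
      by (intro taylor_remainder_powr[where \<rho> = \<rho>] DERIV_f cont_f bound_f) auto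
    also have "\<dots> = K1 / (1 - \<theta>) * N * (\<rho> powr \<theta> * \<rho> powr (real m - \<theta>))"
      using m by (simp add: of_nat_diff)
    also have "\<rho> powr \<theta> * \<rho> powr (real m - \<theta>) = \<rho> ^ m"
      using pos by (simp add: powr_add[symmetric] powr_realpow)
    also have "K1 / (1 - \<theta>) * N * \<rho> ^ m \<le> C * N * \<rho> ^ m"
      using pos by (simp add: C_def distrib_right)
    finally have "\<bar>f 0 \<rho> - (\<Sum>k\<le>m - 1. \<rho> ^ k / fact k * f k 0)\<bar> \<le> C * N * \<rho> ^ m" .
    moreover have "f 0 \<rho> = (\<integral>z. G (\<lambda>_. 0) (c + \<rho> *\<^sub>R z) * tensor u z \<partial>lborel)"
      by (simp add: f_def I_def mi_abs_zero_eq mi_fact_def tensor_mi_weight mi_pow_def)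
    moreover have "(\<Sum>k\<le>m - 1. \<rho> ^ k / fact k * f k 0) =
        (\<integral>z. taylor_jet m G c (c + \<rho> *\<^sub>R z) * tensor u z \<partial>lborel)"
      by (simp add: taylor_jet_average[OF u(1) m] f_def I_def)
    ultimately show ?thesis by simp
  qed
  ultimately show ?thesis by blast
qed

lemma bump_le_1: "bump t \<le> 1"
  unfolding bump_def flat_exp_def by (auto intro!: mult_le_one)

lemma admissible_bump_shift: "admissible (\<lambda>i t. bump (t - v $ i))"
proof -
  have "smooth (\<lambda>t. bump (1 * t + - v $ i))" for i
    by (rule smooth_affine[OF smooth_bump])
  moreover have "bump (t - v $ i) = 0" if "\<bar>t\<bar> > 1 + \<bar>v $ i\<bar>" for t i
    using that by (intro bump_eq_0) linarith
  ultimately show ?thesis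
    unfolding admissible_def by (intro allI conjI exI impI) simp_all
qed

lemma admissible_bump: "admissible (\<lambda>_. bump)"
  using admissible_bump_shift[of 0] by simp

lemma integral_bump_pos: "(\<integral>z. tensor (\<lambda>_. bump) (z :: real^'n::finite) \<partial>lborel) > 0"
proof -
  let ?\<beta> = "tensor (\<lambda>_. bump) :: real^'n \<Rightarrow> real"
  let ?a = "0 - (\<chi> i. 1) :: real^'n" and ?b = "0 + (\<chi> i. 1) :: real^'n"
  have cont: "continuous_on S ?\<beta>" for S
    by (rule continuous_on_tensor[OF admissible_bump])
  have nonneg: "?\<beta> z \<ge> 0" for z
    unfolding tensor_def by (intro prod_nonneg) (simp add: bump_nonneg)
  have eq: "(\<integral>z. ?\<beta> z \<partial>lborel) = integral (cbox ?a ?b) ?\<beta>"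
    using tensor_notin_cbox[of 1 0 "\<lambda>_. bump"] bump_eq_0
    by (intro continuous_support_integral(2) cont) auto
  have "integral (cbox ?a ?b) ?\<beta> \<noteq> 0"
  proof
    assume "integral (cbox ?a ?b) ?\<beta> = 0"
    then have "(?\<beta> has_integral 0) (cbox ?a ?b)"
      using integrable_integral[OF integrable_continuous[OF cont, of ?a ?b]] by simp
    then have "?\<beta> 0 = 0"
      using nonneg by (intro has_integral_0_cbox_imp_0[OF cont]) (auto simp: mem_box_cart box_ne_empty Basis_vec_def inner_axis)
    moreover have "?\<beta> 0 > 0"
      unfolding tensor_def by (intro prod_pos) (simp add: bump_0_pos)
    ultimately show False by simp
  qed
  moreover have "(\<integral>z. ?\<beta> z \<partial>lborel) \<ge> 0"
    using nonneg by (rule Bochner_Integration.integral_nonneg)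
  ultimately show ?thesis using eq by simp
qed

lemma continuous_on_taylor_jet: "continuous_on S (taylor_jet m G y)"
  unfolding taylor_jet_def mi_pow_def by (intro continuous_intros) auto

text \<open>Both Taylor polynomials approximate \<open>G 0\<close> on average at the scales \<open>r, 2r, \<dots>, mr\<close> around \<open>x\<close>.
  Their values at \<open>x\<close> are recovered because the \<open>m\<close>-th finite difference in the scale of a
  polynomial of degree less than \<open>m\<close> vanishes.\<close>

lemma taylor_jet_pointwise:
  fixes q :: real
  assumes m: "m \<ge> 1" and q: "q > real CARD('n::finite)"
  shows "\<exists>C>0. \<forall>(F :: real^'n \<Rightarrow> real) G x y N. jet_of m F G \<longrightarrow> N > 0 \<longrightarrow>
    (\<forall>t>0. (\<integral>\<^sup>+ w. ennreal (grad_norm m G w powr q) * indicator (ball x t) w \<partial>lborel)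
      \<le> ennreal (t ^ CARD('n) * N powr q)) \<longrightarrow>
    \<bar>taylor_jet m G x x - taylor_jet m G y x\<bar> \<le> C * N * norm (x - y) ^ m"
proof -
  obtain C0 where C0: "C0 > 0" and est: "\<And>(F :: real^'n \<Rightarrow> real) G u c x \<rho> N.
    jet_of m F G \<Longrightarrow> admissible u \<Longrightarrow>
    (\<forall>i t. \<bar>t\<bar> > 2 \<longrightarrow> u i t = 0) \<Longrightarrow> (\<forall>i t. \<bar>u i t\<bar> \<le> 1) \<Longrightarrow> N > 0 \<Longrightarrow> \<rho> > 0 \<Longrightarrow> norm (x - c) \<le> \<rho> \<Longrightarrow>
    (\<forall>t>0. (\<integral>\<^sup>+ w. ennreal (grad_norm m G w powr q) * indicator (ball x t) w \<partial>lborel)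
      \<le> ennreal (t ^ CARD('n) * N powr q)) \<Longrightarrow>
    \<bar>(\<integral>z. G (\<lambda>_. 0) (c + \<rho> *\<^sub>R z) * tensor u z \<partial>lborel) -
      (\<integral>z. taylor_jet m G c (c + \<rho> *\<^sub>R z) * tensor u z \<partial>lborel)\<bar> \<le> C0 * N * \<rho> ^ m"
    using taylor_average_bound[OF assms] by blast
  define \<beta> where "\<beta> = (tensor (\<lambda>_. bump) :: real^'n \<Rightarrow> real)"
  define b where "b = (\<integral>z. \<beta> z \<partial>lborel)"
  have b: "b > 0" unfolding b_def \<beta>_def by (rule integral_bump_pos)
  define C where "C = 2 ^ m * (2 * C0 * real m ^ m) / b"
  have "C > 0" using C0 b m by (simp add: C_def)
  moreover have "\<bar>taylor_jet m G x x - taylor_jet m G y x\<bar> \<le> C * N * norm (x - y) ^ m"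
    if jet: "jet_of m F G" and N: "N > 0" and ball: "\<forall>t>0. (\<integral>\<^sup>+ w. ennreal (grad_norm m G w powr q) * indicator (ball x t) w \<partial>lborel)
      \<le> ennreal (t ^ CARD('n) * N powr q)"
    for F :: "real^'n \<Rightarrow> real" and G x y N
  proof (cases "x = y")
    case True
    then show ?thesis using \<open>C > 0\<close> N by simp
  next
    case False
    define r where "r = norm (x - y)"
    have r: "r > 0" using False by (simp add: r_def)
    define avg where "avg = (\<lambda>g k. \<integral>z. g (x + (real k * r) *\<^sub>R z) * \<beta> z \<partial>lborel)"
    have G0: "continuous_on UNIV (G (\<lambda>_. 0))"
      using jet m by (simp add: jet_of_def mi_abs_def)
    have near_x: "\<bar>avg (G (\<lambda>_. 0)) k - avg (taylor_jet m G x) k\<bar> \<le> C0 * N * (real k * r) ^ m"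
      if k: "k \<ge> 1" for k
      unfolding avg_def \<beta>_def
      by (rule est[OF jet admissible_bump]) (use k r N ball bump_eq_0 bump_nonneg bump_le_1 in auto)
    have near_y: "\<bar>avg (G (\<lambda>_. 0)) k - avg (taylor_jet m G y) k\<bar> \<le> C0 * N * (real k * r) ^ m"
      if k: "k \<ge> 1" for k
    proof -
      define v where "v = (1 / (real k * r)) *\<^sub>R (x - y)"
      have kr: "real k * r > 0" using k r by simp
      have "norm v = 1 / real k"
        using r k by (simp add: v_def r_def[symmetric])
      then have "norm v \<le> 1" using k by simp
      then have v: "\<bar>v $ i\<bar> \<le> 1" for i
        using component_le_norm_cart[of v i] by linarith
      have shift: "(\<integral>z. g (y + (real k * r) *\<^sub>R z) * tensor (\<lambda>i t. bump (t - v $ i)) z \<partial>lborel) = avg g k"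
        if g: "continuous_on UNIV g" for g
      proof -
        have "y + (real k * r) *\<^sub>R (v + 1 *\<^sub>R z) = x + (real k * r) *\<^sub>R z" for z
          using k r by (simp add: v_def scaleR_add_right)
        moreover have "tensor (\<lambda>i t. bump (t - v $ i)) (v + 1 *\<^sub>R z) = \<beta> z" for z
          by (simp add: \<beta>_def tensor_def)
        moreover have "(\<lambda>z. g (y + (real k * r) *\<^sub>R z) * tensor (\<lambda>i t. bump (t - v $ i)) z) \<in> borel_measurable borel"
          by (intro borel_measurable_continuous_onI continuous_on_mult continuous_on_tensor admissible_bump_shift
              continuous_on_compose2[OF g] continuous_intros) auto
        ultimately show ?thesis
          by (subst lborel_integral_affine[of _ 1 v]) (simp_all only: avg_def power_one mult_1 zero_less_one)
      qed
      have "\<bar>(\<integral>z. G (\<lambda>_. 0) (y + (real k * r) *\<^sub>R z) * tensor (\<lambda>i t. bump (t - v $ i)) z \<partial>lborel) -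
        (\<integral>z. taylor_jet m G y (y + (real k * r) *\<^sub>R z) * tensor (\<lambda>i t. bump (t - v $ i)) z \<partial>lborel)\<bar> \<le> C0 * N * (real k * r) ^ m"
      proof (rule est[OF jet admissible_bump_shift _ _ N kr _ ball])
        show "\<forall>i t. 2 < \<bar>t\<bar> \<longrightarrow> bump (t - v $ i) = 0"
        proof (intro allI impI bump_eq_0)
          fix i t assume "2 < \<bar>t::real\<bar>"
          with v[of i] show "1 < \<bar>t - v $ i\<bar>" by linarith
        qed
        show "\<forall>i t. \<bar>bump (t - v $ i)\<bar> \<le> 1"
          using bump_nonneg bump_le_1 by simp
        show "norm (x - y) \<le> real k * r"
          using k r by (simp add: r_def[symmetric])
      qed
      then show ?thesis
        by (simp only: shift[OF G0] shift[OF continuous_on_taylor_jet])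
    qed
    define D where "D = (\<lambda>k. avg (taylor_jet m G x) k - avg (taylor_jet m G y) k)"
    have D_le: "\<bar>D k\<bar> \<le> 2 * C0 * N * (real m * r) ^ m" if "1 \<le> k" "k \<le> m" for k
    proof -
      have "\<bar>D k\<bar> \<le> 2 * C0 * N * (real k * r) ^ m"
        using near_x[OF that(1)] near_y[OF that(1)] unfolding D_def by linarith
      also have "\<dots> \<le> 2 * C0 * N * (real m * r) ^ m"
        using that r C0 N by (intro mult_left_mono power_mono mult_right_mono) auto
      finally show ?thesis .
    qed
    have diff: "(\<Sum>k\<le>m. (-1) ^ k * real (m choose k) * avg (taylor_jet m G y') k) = 0" for y'
    proof -
      have int: "integrable lborel (\<lambda>z. taylor_jet m G y' (x + (real k * r) *\<^sub>R z) * \<beta> z)" for k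
        unfolding \<beta>_def
        by (intro integrable_continuous_tensor admissible_bump
            continuous_on_compose2[OF continuous_on_taylor_jet[of UNIV]] continuous_intros) auto
      have "(\<Sum>k\<le>m. (-1) ^ k * real (m choose k) * taylor_jet m G y' (x + (real k * r) *\<^sub>R z)) = 0" for z
      proof -
        obtain P where "degree P < m" "\<And>t. taylor_jet m G y' (x + t *\<^sub>R (r *\<^sub>R z)) = poly P t"
          using taylor_jet_line_eq_poly[OF m, of G y' x "r *\<^sub>R z"] by blast
        then show ?thesis
          using alternating_sum_poly_eq_0[of P m] by simp
      qed
      then have "0 = (\<integral>z. (\<Sum>k\<le>m. (-1) ^ k * real (m choose k) * taylor_jet m G y' (x + (real k * r) *\<^sub>R z)) * \<beta> z \<partial>lborel)"
        by simp
      also have "\<dots> = (\<integral>z. (\<Sum>k\<le>m. (-1) ^ k * real (m choose k) * (taylor_jet m G y' (x + (real k * r) *\<^sub>R z) * \<beta> z)) \<partial>lborel)"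
        by (simp add: sum_distrib_right mult.assoc)
      also have "\<dots> = (\<Sum>k\<le>m. (-1) ^ k * real (m choose k) * avg (taylor_jet m G y') k)"
        using int unfolding avg_def by (subst Bochner_Integration.integral_sum) auto
      finally show ?thesis by simp
    qed
    have "0 = (\<Sum>k\<le>m. (-1) ^ k * real (m choose k) * D k)"
      using diff[of x] diff[of y] by (simp add: D_def right_diff_distrib sum_subtractf)
    also have "\<dots> = D 0 + (\<Sum>k\<in>{1..m}. (-1) ^ k * real (m choose k) * D k)"
    proof -
      have "{..m} = insert 0 {1..m}" by auto
      then show ?thesis by simp
    qed
    finally have "\<bar>D 0\<bar> = \<bar>\<Sum>k\<in>{1..m}. (-1) ^ k * real (m choose k) * D k\<bar>"
      by linarith
    also have "\<dots> \<le> (\<Sum>k\<in>{1..m}. real (m choose k) * (2 * C0 * N * (real m * r) ^ m))"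
    proof (rule order_trans[OF sum_abs], rule sum_mono)
      fix k assume "k \<in> {1..m}"
      then show "\<bar>(-1) ^ k * real (m choose k) * D k\<bar> \<le> real (m choose k) * (2 * C0 * N * (real m * r) ^ m)"
        using D_le[of k] by (simp add: abs_mult mult_left_mono)
    qed
    also have "\<dots> \<le> (\<Sum>k\<le>m. real (m choose k) * (2 * C0 * N * (real m * r) ^ m))"
      using C0 N r by (intro sum_mono2) auto
    also have "\<dots> = 2 ^ m * (2 * C0 * N * (real m * r) ^ m)"
      unfolding sum_distrib_right[symmetric] of_nat_sum[symmetric] choose_row_sum by simp
    finally have "\<bar>D 0\<bar> \<le> 2 ^ m * (2 * C0 * N * (real m * r) ^ m)" .
    moreover have "D 0 = (taylor_jet m G x x - taylor_jet m G y x) * b"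
      by (simp add: D_def avg_def b_def left_diff_distrib)
    ultimately have "\<bar>taylor_jet m G x x - taylor_jet m G y x\<bar> * b \<le> 2 ^ m * (2 * C0 * N * (real m * r) ^ m)"
      using b by (simp add: abs_mult)
    then show ?thesis
      using b by (simp add: C_def r_def[symmetric] pos_le_divide_eq power_mult_distrib mult_ac)
  qed
  ultimately show ?thesis by blast
qed

lemma borel_measurable_enn_powr: "(\<lambda>a. enn_powr a r) \<in> borel_measurable borel"
proof -
  have "(\<lambda>a. ennreal (enn2real a powr r)) \<in> borel_measurable borel"
    by measurable
  then show ?thesis
    unfolding enn_powr_def by (intro measurable_If) auto
qed

lemma Lp_grad_norm:
  fixes G :: "('n::finite \<Rightarrow> nat) \<Rightarrow> real^'n \<Rightarrow> real"
  assumes "\<And>j. mi_abs j = m \<Longrightarrow> Lp p (G j)" "p > 0"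
  shows "integrable lborel (\<lambda>x. grad_norm m G x powr p)"
proof -
  let ?S = "{j::'n \<Rightarrow> nat. mi_abs j = m}"
  define c where "c = real (card ?S)"
  have fin: "finite ?S" by (rule finite_mi_eq)
  have bound: "grad_norm m G x powr p \<le> c powr p * (\<Sum>j\<in>?S. \<bar>G j x\<bar> powr p)" for x
  proof (cases "?S = {}")
    case True
    then show ?thesis by (simp add: grad_norm_def)
  next
    case False
    define M where "M = Max ((\<lambda>j. \<bar>G j x\<bar>) ` ?S)"
    have "M \<in> (\<lambda>j. \<bar>G j x\<bar>) ` ?S"
      unfolding M_def using fin False by (intro Max_in) auto
    then obtain j where j: "j \<in> ?S" "M = \<bar>G j x\<bar>"
      by blast
    have "grad_norm m G x \<le> (\<Sum>j\<in>?S. \<bar>G j x\<bar>)"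
      using L2_set_le_sum_abs[of "\<lambda>j. G j x" ?S] by (simp add: grad_norm_def L2_set_def)
    also have "\<dots> \<le> (\<Sum>j\<in>?S. M)"
      using fin by (intro sum_mono) (auto simp: M_def)
    finally have "grad_norm m G x \<le> c * M" by (simp add: c_def)
    then have "grad_norm m G x powr p \<le> (c * M) powr p"
      using assms(2) by (intro powr_mono2) (auto simp: grad_norm_def intro: sum_nonneg)
    also have "\<dots> = c powr p * \<bar>G j x\<bar> powr p"
      using j by (simp add: powr_mult c_def)
    also have "\<dots> \<le> c powr p * (\<Sum>j\<in>?S. \<bar>G j x\<bar> powr p)"
      using j fin by (intro mult_left_mono member_le_sum) auto
    finally show ?thesis .
  qed
  have "integrable lborel (\<lambda>x. c powr p * (\<Sum>j\<in>?S. \<bar>G j x\<bar> powr p))"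
    using assms(1) by (intro integrable_mult_right Bochner_Integration.integrable_sum) (simp add: Lp_def)
  moreover have "(\<lambda>x. grad_norm m G x powr p) \<in> borel_measurable lborel"
  proof -
    have "(\<lambda>x. \<Sum>j\<in>?S. (G j x)\<^sup>2) \<in> borel_measurable lborel"
      using assms(1) by (intro borel_measurable_sum borel_measurable_power) (simp add: Lp_def)
    note [measurable] = this
    show ?thesis
      unfolding grad_norm_def by measurable
  qed
  moreover have "norm (grad_norm m G x powr p) \<le> norm (c powr p * (\<Sum>j\<in>?S. \<bar>G j x\<bar> powr p))" for x
    unfolding real_norm_def abs_of_nonneg[OF powr_ge_zero]
    by (rule order_trans[OF bound abs_ge_self])
  ultimately show ?thesis
    by (rule Bochner_Integration.integrable_bound[OF _ _ AE_I2])
qed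

theorem mainTheorem15:
  fixes m :: nat and p :: real
  assumes "m \<ge> 1" and "p > real CARD('n::finite)"
  shows "\<exists>C>0. \<forall>(K :: (real^'n) set) (F :: real^'n \<Rightarrow> real) (G :: ('n \<Rightarrow> nat) \<Rightarrow> real^'n \<Rightarrow> real).
           compact K \<and> sobolev m p F \<and>
           (\<forall>j. mi_abs j \<le> m \<longrightarrow> Lp p (G j) \<and> weak_deriv j F (G j)) \<and>
           (\<forall>j. mi_abs j \<le> m - 1 \<longrightarrow> continuous_on UNIV (G j))
           \<longrightarrow> Lp_norm_enn p (Mjet m K G) \<le> ennreal (C * Lp_norm p (grad_norm m G))"
proof -
  define q where "q = (real CARD('n) + p) / 2"
  have q: "q > real CARD('n)" "q < p" "q > 0"
    using assms(2) by (auto simp: q_def)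
  have p: "p > 0" using q by simp
  have "p / q > 1" using q by simp
  then obtain A where A: "A > 0" and hl: "\<And>u::real^'n \<Rightarrow> real. u \<in> borel_measurable borel \<Longrightarrow> (\<forall>x. u x \<ge> 0) \<Longrightarrow>
    (\<integral>\<^sup>+ x. enn_powr (hl_max u x) (p / q) \<partial>lborel) \<le> ennreal A * (\<integral>\<^sup>+ x. ennreal (u x powr (p / q)) \<partial>lborel)"
    using hl_max_strong_type[where 'a = "real^'n"] by blast
  obtain B where B: "B > 0" and pw: "\<And>(F :: real^'n \<Rightarrow> real) G x y N. jet_of m F G \<Longrightarrow> N > 0 \<Longrightarrow>
    (\<forall>t>0. (\<integral>\<^sup>+ w. ennreal (grad_norm m G w powr q) * indicator (ball x t) w \<partial>lborel)
      \<le> ennreal (t ^ CARD('n) * N powr q)) \<Longrightarrow>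
    \<bar>taylor_jet m G x x - taylor_jet m G y x\<bar> \<le> B * N * norm (x - y) ^ m"
    using taylor_jet_pointwise[OF assms(1) q(1)] by blast
  define C where "C = (B powr p * A) powr (1 / p)"
  have "C > 0" using A B by (simp add: C_def)
  moreover have "Lp_norm_enn p (Mjet m K G) \<le> ennreal (C * Lp_norm p (grad_norm m G))"
    if G: "\<And>j. mi_abs j \<le> m \<Longrightarrow> Lp p (G j) \<and> weak_deriv j F (G j)"
      and cont: "\<And>j. mi_abs j \<le> m - 1 \<Longrightarrow> continuous_on UNIV (G j)"
    for K and F :: "real^'n \<Rightarrow> real" and G
  proof -
    have jet: "jet_of m F G"
      using G cont assms(1) by (auto simp: jet_of_def Lp_def)
    define h where "h = grad_norm m G"
    have h0: "h x \<ge> 0" for x by (simp add: h_def grad_norm_def sum_nonneg)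
    have h_meas [measurable]: "h \<in> borel_measurable borel"
      unfolding h_def using jet by (intro borel_measurable_grad_norm) (simp add: jet_of_def)
    define u where "u = (\<lambda>x. h x powr q)"
    have u_meas [measurable]: "u \<in> borel_measurable borel" unfolding u_def by measurable
    have Mjet_le: "Mjet m K G x \<le> ennreal (B * N)"
      if N: "N > 0" "hl_max u x \<le> ennreal (N powr q)" for x N
    proof -
      have "\<forall>t>0. (\<integral>\<^sup>+ w. ennreal (grad_norm m G w powr q) * indicator (ball x t) w \<partial>lborel)
          \<le> ennreal (t ^ CARD('n) * N powr q)"
        using nn_integral_ball_le_hl_max[OF N(2)] by (simp add: u_def h_def ennreal_mult)
      then have *: "\<bar>taylor_jet m G x x - taylor_jet m G y x\<bar> \<le> B * N * norm (x - y) ^ m" for y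
        by (rule pw[OF jet N(1)])
      have "\<bar>taylor_jet m G y x - taylor_jet m G z x\<bar> / (norm (x - y) ^ m + norm (x - z) ^ m) \<le> B * N" for y z
      proof -
        have "\<bar>taylor_jet m G y x - taylor_jet m G z x\<bar> \<le> B * N * (norm (x - y) ^ m + norm (x - z) ^ m)"
          using *[of y] *[of z] unfolding distrib_left by linarith
        then show ?thesis
          using B N(1) by (cases "norm (x - y) ^ m + norm (x - z) ^ m = 0")
            (auto simp: pos_divide_le_eq add_nonneg_pos less_le)
      qed
      then show ?thesis
        unfolding Mjet_def by (intro SUP_least ennreal_leI) (auto split: prod.splits)
    qed
    have pointwise: "enn_powr (Mjet m K G x) p \<le> ennreal (B powr p) * enn_powr (hl_max u x) (p / q)" for x
    proof (cases "hl_max u x")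
      case (real \<mu>)
      have "Mjet m K G x \<le> ennreal (B * \<mu> powr (1 / q))"
      proof (rule ennreal_le_epsilon)
        fix e :: real assume e: "e > 0"
        define N where "N = \<mu> powr (1 / q) + e / B"
        have N: "N > 0" using e B by (simp add: N_def add_nonneg_pos)
        have "(\<mu> powr (1 / q)) powr q \<le> N powr q"
          using q e B by (intro powr_mono2) (auto simp: N_def)
        then have "\<mu> \<le> N powr q" using q real by (simp add: powr_powr)
        then have "Mjet m K G x \<le> ennreal (B * N)"
          using real by (intro Mjet_le N) (simp add: ennreal_leI)
        also have "B * N = B * \<mu> powr (1 / q) + e"
          using B by (simp add: N_def distrib_left)
        finally show "Mjet m K G x \<le> ennreal (B * \<mu> powr (1 / q)) + ennreal e"
          using B e by (simp add: ennreal_plus)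
      qed
      then obtain a where a: "Mjet m K G x = ennreal a" "0 \<le> a" "a \<le> B * \<mu> powr (1 / q)"
        using B by (subst (asm) le_ennreal_iff) auto
      have "a powr p \<le> (B * \<mu> powr (1 / q)) powr p"
        using a p by (intro powr_mono2) auto
      also have "\<dots> = B powr p * \<mu> powr (p / q)"
        using B by (simp add: powr_mult powr_powr)
      finally show ?thesis
        using a real by (simp add: enn_powr_def ennreal_mult[symmetric])
    next
      case top
      then show ?thesis using B by (simp add: enn_powr_def ennreal_mult_top)
    qed
    have int: "integrable lborel (\<lambda>x. h x powr p)"
      unfolding h_def using G p by (intro Lp_grad_norm) auto
    define J where "J = (\<integral>x. h x powr p \<partial>lborel)"
    have J: "J \<ge> 0" unfolding J_def by (intro Bochner_Integration.integral_nonneg) auto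
    have "(\<integral>\<^sup>+ x. enn_powr (Mjet m K G x) p \<partial>lborel) \<le> (\<integral>\<^sup>+ x. ennreal (B powr p) * enn_powr (hl_max u x) (p / q) \<partial>lborel)"
      by (intro nn_integral_mono pointwise)
    also have "\<dots> = ennreal (B powr p) * (\<integral>\<^sup>+ x. enn_powr (hl_max u x) (p / q) \<partial>lborel)"
      using measurable_compose[OF borel_measurable_hl_max borel_measurable_enn_powr]
      by (intro nn_integral_cmult) simp
    also have "\<dots> \<le> ennreal (B powr p) * (ennreal A * (\<integral>\<^sup>+ x. ennreal (u x powr (p / q)) \<partial>lborel))"
      by (intro mult_left_mono hl u_meas) (auto simp: u_def)
    also have "(\<integral>\<^sup>+ x. ennreal (u x powr (p / q)) \<partial>lborel) = ennreal J"
      unfolding J_def using int q by (subst nn_integral_eq_integral[symmetric]) (auto simp: u_def powr_powr)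
    also have "ennreal (B powr p) * (ennreal A * ennreal J) = ennreal (B powr p * A * J)"
      using A J by (simp add: ennreal_mult[symmetric] mult.assoc)
    finally obtain a where a: "(\<integral>\<^sup>+ x. enn_powr (Mjet m K G x) p \<partial>lborel) = ennreal a" "0 \<le> a" "a \<le> B powr p * A * J"
      using A J by (subst (asm) le_ennreal_iff) auto
    have "a powr (1 / p) \<le> (B powr p * A * J) powr (1 / p)"
      using a p by (intro powr_mono2) auto
    also have "\<dots> = C * J powr (1 / p)"
      using A J by (simp add: C_def powr_mult)
    also have "J powr (1 / p) = Lp_norm p (grad_norm m G)"
      using h0 by (simp add: J_def Lp_norm_def h_def[symmetric])
    finally show ?thesis
      using a by (simp add: Lp_norm_enn_def enn_powr_def ennreal_leI)
  qed
  ultimately show ?thesis by blast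
qed

end
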